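(* The category $\mathsf{FC}(\mathbf{Set},\mathbf{Set})$ of finite-coproduct-preserving endofunctors of $\mathbf{Set}$ (and all natural transformations between them) is equivalent to the functor category $[\mathcal{UF},\mathbf{Set}]$.
   Context: An ultrafilter on a set $X$ is a collection $\mathcal U$ of subsets of $X$ with $X\in\mathcal U$; $U\cap V\in\mathcal U$ iff ($U\in\mathcal U$ and $V\in\mathcal U$); and $U\in\mathcal U$ iff $X\setminus U\notin\mathcal U$. $\beta X$ denotes the set of ultrafilters on $X$. The category $\mathcal{UF}$ of ultrafilters has as objects pairs $(X,\mathcal U)$ with $X$ a set and $\mathcal U\in\beta X$. A partial function $f\colon X\rightharpoonup Y$ defined on a set in $\mathcal U$ is continuous $(X,\mathcal U)\rightharpoonup(Y,\mathcal V)$ if for all $V\subseteq Y$: $V\in\mathcal V$ iff $f^{-1}(V)\in\mathcal U$. Two such partial functions are $=_{\mathcal U}$-equivalent if $\{x : f(x)\text{ and }g(x)\text{ are both defined and equal}\}\in\mathcal U$. Morphisms $(X,\mathcal U)\to(Y,\mathcal V)$ in $\mathcal{UF}$ are $=_{\mathcal U}$-equivalence classes of partial continuous functions defined on a set in $\mathcal U$, with composition induced by composition of partial functions. *)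

theory Defs
  imports "HOL-Library.FuncSet"
begin

section \<open>Categories, functors, natural transformations\<close>

text \<open>
  Hom-sets are indexed by source and target and need not be disjoint, so composition is
  indexed by three objects: \<open>Comp C X Y Z g f\<close> is \<open>g \<circ> f\<close> for
  \<open>f : X \<rightarrow> Y\<close> and \<open>g : Y \<rightarrow> Z\<close>.
\<close>

record ('o, 'a) cat =
  Obj :: "'o set"
  Hom :: "'o \<Rightarrow> 'o \<Rightarrow> 'a set"
  Id :: "'o \<Rightarrow> 'a"
  Comp :: "'o \<Rightarrow> 'o \<Rightarrow> 'o \<Rightarrow> 'a \<Rightarrow> 'a \<Rightarrow> 'a"

definition category :: "('o, 'a) cat \<Rightarrow> bool" where
  "category C \<longleftrightarrow>
     (\<forall>X\<in>Obj C. Id C X \<in> Hom C X X) \<and>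
     (\<forall>X\<in>Obj C. \<forall>Y\<in>Obj C. \<forall>Z\<in>Obj C. \<forall>f\<in>Hom C X Y. \<forall>g\<in>Hom C Y Z.
        Comp C X Y Z g f \<in> Hom C X Z) \<and>
     (\<forall>X\<in>Obj C. \<forall>Y\<in>Obj C. \<forall>f\<in>Hom C X Y.
        Comp C X X Y f (Id C X) = f \<and> Comp C X Y Y (Id C Y) f = f) \<and>
     (\<forall>W\<in>Obj C. \<forall>X\<in>Obj C. \<forall>Y\<in>Obj C. \<forall>Z\<in>Obj C.
        \<forall>f\<in>Hom C W X. \<forall>g\<in>Hom C X Y. \<forall>h\<in>Hom C Y Z.
        Comp C W X Z (Comp C X Y Z h g) f = Comp C W Y Z h (Comp C W X Y g f))"

definition isomorphism :: "('o, 'a) cat \<Rightarrow> 'o \<Rightarrow> 'o \<Rightarrow> 'a \<Rightarrow> bool" where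
  "isomorphism C X Y f \<longleftrightarrow>
     f \<in> Hom C X Y \<and>
     (\<exists>g\<in>Hom C Y X. Comp C X Y X g f = Id C X \<and> Comp C Y X Y f g = Id C Y)"

definition full_subcategory :: "('o, 'a) cat \<Rightarrow> 'o set \<Rightarrow> ('o, 'a) cat" where
  "full_subcategory C S = C\<lparr>Obj := Obj C \<inter> S\<rparr>"

record ('o, 'a, 'p, 'b) fctr =
  FObj :: "'o \<Rightarrow> 'p"
  FMap :: "'o \<Rightarrow> 'o \<Rightarrow> 'a \<Rightarrow> 'b"

text \<open>
  The object and arrow maps of a functor, and the components of a natural transformation, are
  required to be \<open>undefined\<close> outside their domains, so that HOL equality of functors and of
  natural transformations is the mathematical one.
\<close>

definition is_functor ::
    "('o, 'a) cat \<Rightarrow> ('p, 'b) cat \<Rightarrow> ('o, 'a, 'p, 'b) fctr \<Rightarrow> bool" where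
  "is_functor C D F \<longleftrightarrow>
     FObj F \<in> Obj C \<rightarrow>\<^sub>E Obj D \<and>
     (\<forall>X\<in>Obj C. \<forall>Y\<in>Obj C.
        FMap F X Y \<in> Hom C X Y \<rightarrow>\<^sub>E Hom D (FObj F X) (FObj F Y)) \<and>
     (\<forall>X Y. X \<notin> Obj C \<or> Y \<notin> Obj C \<longrightarrow> FMap F X Y = (\<lambda>_. undefined)) \<and>
     (\<forall>X\<in>Obj C. FMap F X X (Id C X) = Id D (FObj F X)) \<and>
     (\<forall>X\<in>Obj C. \<forall>Y\<in>Obj C. \<forall>Z\<in>Obj C. \<forall>f\<in>Hom C X Y. \<forall>g\<in>Hom C Y Z.
        FMap F X Z (Comp C X Y Z g f) =
        Comp D (FObj F X) (FObj F Y) (FObj F Z) (FMap F Y Z g) (FMap F X Y f))"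

definition id_functor :: "('o, 'a) cat \<Rightarrow> ('o, 'a, 'o, 'a) fctr" where
  "id_functor C = \<lparr>
     FObj = (\<lambda>X\<in>Obj C. X),
     FMap = (\<lambda>X Y f. if X \<in> Obj C \<and> Y \<in> Obj C \<and> f \<in> Hom C X Y then f else undefined) \<rparr>"

definition comp_functor ::
    "('o, 'a) cat \<Rightarrow> ('p, 'b, 'q, 'c) fctr \<Rightarrow> ('o, 'a, 'p, 'b) fctr \<Rightarrow> ('o, 'a, 'q, 'c) fctr" where
  "comp_functor C G F = \<lparr>
     FObj = (\<lambda>X\<in>Obj C. FObj G (FObj F X)),
     FMap = (\<lambda>X Y f. if X \<in> Obj C \<and> Y \<in> Obj C \<and> f \<in> Hom C X Y
               then FMap G (FObj F X) (FObj F Y) (FMap F X Y f) else undefined) \<rparr>"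

definition nat_trans ::
    "('o, 'a) cat \<Rightarrow> ('p, 'b) cat \<Rightarrow> ('o, 'a, 'p, 'b) fctr \<Rightarrow> ('o, 'a, 'p, 'b) fctr \<Rightarrow>
     ('o \<Rightarrow> 'b) set" where
  "nat_trans C D F G =
     {t \<in> (\<Pi>\<^sub>E X\<in>Obj C. Hom D (FObj F X) (FObj G X)).
        \<forall>X\<in>Obj C. \<forall>Y\<in>Obj C. \<forall>f\<in>Hom C X Y.
          Comp D (FObj F X) (FObj F Y) (FObj G Y) (t Y) (FMap F X Y f) =
          Comp D (FObj F X) (FObj G X) (FObj G Y) (FMap G X Y f) (t X)}"

definition naturally_isomorphic ::
    "('o, 'a) cat \<Rightarrow> ('p, 'b) cat \<Rightarrow> ('o, 'a, 'p, 'b) fctr \<Rightarrow> ('o, 'a, 'p, 'b) fctr \<Rightarrow> bool" where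
  "naturally_isomorphic C D F G \<longleftrightarrow>
     (\<exists>t\<in>nat_trans C D F G. \<forall>X\<in>Obj C. isomorphism D (FObj F X) (FObj G X) (t X))"

definition functor_category ::
    "('o, 'a) cat \<Rightarrow> ('p, 'b) cat \<Rightarrow> (('o, 'a, 'p, 'b) fctr, 'o \<Rightarrow> 'b) cat" where
  "functor_category C D = \<lparr>
     Obj = {F. is_functor C D F},
     Hom = nat_trans C D,
     Id = (\<lambda>F. \<lambda>X\<in>Obj C. Id D (FObj F X)),
     Comp = (\<lambda>F G H t s. \<lambda>X\<in>Obj C.
               Comp D (FObj F X) (FObj G X) (FObj H X) (t X) (s X)) \<rparr>"

definition equivalent_categories :: "('o, 'a) cat \<Rightarrow> ('p, 'b) cat \<Rightarrow> bool" where
  "equivalent_categories C D \<longleftrightarrow>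
     category C \<and> category D \<and>
     (\<exists>F G. is_functor C D F \<and> is_functor D C G \<and>
        naturally_isomorphic C C (comp_functor C G F) (id_functor C) \<and>
        naturally_isomorphic D D (comp_functor D F G) (id_functor D))"


section \<open>Finite coproducts\<close>

definition is_coproduct ::
    "('o, 'a) cat \<Rightarrow> 'i set \<Rightarrow> ('i \<Rightarrow> 'o) \<Rightarrow> 'o \<Rightarrow> ('i \<Rightarrow> 'a) \<Rightarrow> bool" where
  "is_coproduct C I A P j \<longleftrightarrow>
     (\<forall>i\<in>I. A i \<in> Obj C) \<and> P \<in> Obj C \<and> (\<forall>i\<in>I. j i \<in> Hom C (A i) P) \<and>
     (\<forall>Q\<in>Obj C. \<forall>g. (\<forall>i\<in>I. g i \<in> Hom C (A i) Q) \<longrightarrow>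
        (\<exists>!h. h \<in> Hom C P Q \<and> (\<forall>i\<in>I. Comp C (A i) P Q h (j i) = g i)))"

text \<open>
  Finite index sets may be taken among the finite sets of natural numbers; the empty one gives
  preservation of initial objects.
\<close>

definition preserves_finite_coproducts ::
    "('o, 'a) cat \<Rightarrow> ('p, 'b) cat \<Rightarrow> ('o, 'a, 'p, 'b) fctr \<Rightarrow> bool" where
  "preserves_finite_coproducts C D F \<longleftrightarrow>
     (\<forall>(I :: nat set) A P j. finite I \<and> is_coproduct C I A P j \<longrightarrow>
        is_coproduct D I (\<lambda>i. FObj F (A i)) (FObj F P) (\<lambda>i. FMap F (A i) P (j i)))"

definition FC_category ::
    "('o, 'a) cat \<Rightarrow> ('p, 'b) cat \<Rightarrow> (('o, 'a, 'p, 'b) fctr, 'o \<Rightarrow> 'b) cat" where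
  "FC_category C D =
     full_subcategory (functor_category C D) {F. preserves_finite_coproducts C D F}"


section \<open>The category of sets\<close>

text \<open>
  HOL has no type of all sets. The sets are taken to be the elements of an arbitrary type
  \<open>'v\<close> which, with \<open>elts x\<close> the set of members of \<open>x\<close>, satisfies extensionality,
  separation, replacement (for arbitrary HOL functions), union and power set; pairing and the
  empty set follow, and choice is inherited from HOL. Equivalently, \<open>'v\<close> behaves as a
  Grothendieck universe. Foundation and infinity are not needed and not assumed, so the models
  of ZFC are covered, and so is the type of hereditarily finite sets.
\<close>

locale set_universe =
  fixes elts :: "'v \<Rightarrow> 'v set"
  assumes extensionality: "elts x = elts y \<Longrightarrow> x = y"
    and separation: "B \<subseteq> elts x \<Longrightarrow> \<exists>y. elts y = B"
    and replacement: "\<exists>y. elts y = f ` elts x"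
    and union: "\<exists>y. elts y = \<Union> (elts ` elts x)"
    and power_set: "\<exists>y. elts y = {z. elts z \<subseteq> elts x}"

definition Set_category :: "('v \<Rightarrow> 'v set) \<Rightarrow> ('v, 'v \<Rightarrow> 'v) cat" where
  "Set_category elts = \<lparr>
     Obj = UNIV,
     Hom = (\<lambda>X Y. elts X \<rightarrow>\<^sub>E elts Y),
     Id = (\<lambda>X. \<lambda>x\<in>elts X. x),
     Comp = (\<lambda>X Y Z g f. compose (elts X) g f) \<rparr>"


section \<open>The category of ultrafilters\<close>

definition ultrafilter_on :: "'x set \<Rightarrow> 'x set set \<Rightarrow> bool" where
  "ultrafilter_on X \<U> \<longleftrightarrow>
     \<U> \<subseteq> Pow X \<and> X \<in> \<U> \<and>
     (\<forall>U V. U \<subseteq> X \<and> V \<subseteq> X \<longrightarrow> (U \<inter> V \<in> \<U> \<longleftrightarrow> U \<in> \<U> \<and> V \<in> \<U>)) \<and>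
     (\<forall>U. U \<subseteq> X \<longrightarrow> (U \<in> \<U> \<longleftrightarrow> X - U \<notin> \<U>))"

definition partial_continuous ::
    "'x set \<Rightarrow> 'x set set \<Rightarrow> 'y set \<Rightarrow> 'y set set \<Rightarrow> ('x \<rightharpoonup> 'y) set" where
  "partial_continuous X \<U> Y \<V> =
     {f. dom f \<subseteq> X \<and> ran f \<subseteq> Y \<and> dom f \<in> \<U> \<and>
         (\<forall>V. V \<subseteq> Y \<longrightarrow> (V \<in> \<V> \<longleftrightarrow> f -` (Some ` V) \<in> \<U>))}"

definition eq_mod ::
    "'x set \<Rightarrow> 'x set set \<Rightarrow> 'y set \<Rightarrow> 'y set set \<Rightarrow> (('x \<rightharpoonup> 'y) \<times> ('x \<rightharpoonup> 'y)) set" where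
  "eq_mod X \<U> Y \<V> =
     {(f, g). f \<in> partial_continuous X \<U> Y \<V> \<and> g \<in> partial_continuous X \<U> Y \<V> \<and>
              {x. \<exists>y. f x = Some y \<and> g x = Some y} \<in> \<U>}"

text \<open>
  The union in the definition of composition is the usual idiom for a function on equivalence
  classes: all the classes united are equal.
\<close>

definition UF_category ::
    "('v \<Rightarrow> 'v set) \<Rightarrow> ('v \<times> 'v set set, ('v \<rightharpoonup> 'v) set) cat" where
  "UF_category elts = \<lparr>
     Obj = {(X, \<U>). ultrafilter_on (elts X) \<U>},
     Hom = (\<lambda>(X, \<U>) (Y, \<V>).
              partial_continuous (elts X) \<U> (elts Y) \<V> // eq_mod (elts X) \<U> (elts Y) \<V>),
     Id = (\<lambda>(X, \<U>). eq_mod (elts X) \<U> (elts X) \<U> `` {Some |` elts X}),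
     Comp = (\<lambda>(X, \<U>) (Y, \<V>) (Z, \<W>) G F.
              \<Union>f\<in>F. \<Union>g\<in>G. eq_mod (elts X) \<U> (elts Z) \<W> `` {g \<circ>\<^sub>m f}) \<rparr>"

end

theory Submission
  imports Defs
begin

text \<open>
  Let \<open>F\<close> preserve finite coproducts and \<open>x \<in> F X\<close>. Since \<open>F X\<close> is the disjoint union of
  \<open>F A\<close> and \<open>F (X - A)\<close>, the sets \<open>A \<subseteq> X\<close> such that \<open>x\<close> comes from \<open>F A\<close> form an
  ultrafilter on \<open>X\<close>. Hence \<open>F X\<close> is the disjoint union, over the ultrafilters \<open>U\<close> on \<open>X\<close>,
  of the sets of elements with ultrafilter \<open>U\<close>; these are functorial in \<open>(X, U)\<close>, because the
  value of \<open>F f\<close> at \<open>x\<close> depends only on the restriction of \<open>f\<close> to a member of the ultrafilter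
  of \<open>x\<close>. The resulting functor \<open>FC(Set, Set) \<rightarrow> [UF, Set]\<close> is fully faithful, since naturality
  forces transformations to preserve ultrafilters. It is essentially surjective: given \<open>G\<close>, the
  functor \<open>X \<mapsto> \<Coprod>\<^sub>U G (X, U)\<close> preserves finite coproducts because an ultrafilter contains
  exactly one block of a finite partition and restricts isomorphically to it.
\<close>

section \<open>Categories and equivalences\<close>

text \<open>Functoriality gives upward closure of the sets from which \<open>x\<close> comes, and a
  two-block coproduct gives the complement law. Closure under intersection is the delicate point,
  because \<open>F\<close> is not assumed to preserve intersections; it is won by using the
  complement law a second time, in the value of \<open>F\<close> at a subset. Equalities between
  ultrafilters are obtained throughout from a single inclusion, since an ultrafilter is maximal. Two
  obstacles of representation shape the rest. Arrows between ultrafilters are classes of partial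
  functions, whereas functors on sets act on total functions; hence every arrow is handled through a
  total representative, and continuity is restated as an equation between pushforwards. Moreover, an
  ultrafilter is a HOL set of HOL sets, while the coproduct over all ultrafilters on
  \<open>X\<close> must be an element of the universe; hence the codes and the smallness bound. A
  partial inverse of an injection is likewise replaced by a total retraction, which is an inverse up
  to a member of the ultrafilter.\<close>

lemma category_id: "category C \<Longrightarrow> X \<in> Obj C \<Longrightarrow> Id C X \<in> Hom C X X"
  by (simp add: category_def)

lemma category_comp:
  "category C \<Longrightarrow> X \<in> Obj C \<Longrightarrow> Y \<in> Obj C \<Longrightarrow> Z \<in> Obj C \<Longrightarrow>
    f \<in> Hom C X Y \<Longrightarrow> g \<in> Hom C Y Z \<Longrightarrow> Comp C X Y Z g f \<in> Hom C X Z"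
  by (simp add: category_def)

lemma category_id_right:
  "category C \<Longrightarrow> X \<in> Obj C \<Longrightarrow> Y \<in> Obj C \<Longrightarrow> f \<in> Hom C X Y \<Longrightarrow> Comp C X X Y f (Id C X) = f"
  by (simp add: category_def)

lemma category_id_left:
  "category C \<Longrightarrow> X \<in> Obj C \<Longrightarrow> Y \<in> Obj C \<Longrightarrow> f \<in> Hom C X Y \<Longrightarrow> Comp C X Y Y (Id C Y) f = f"
  by (simp add: category_def)

lemma category_assoc:
  "category C \<Longrightarrow> W \<in> Obj C \<Longrightarrow> X \<in> Obj C \<Longrightarrow> Y \<in> Obj C \<Longrightarrow> Z \<in> Obj C \<Longrightarrow>
    f \<in> Hom C W X \<Longrightarrow> g \<in> Hom C X Y \<Longrightarrow> h \<in> Hom C Y Z \<Longrightarrow>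
    Comp C W X Z (Comp C X Y Z h g) f = Comp C W Y Z h (Comp C W X Y g f)"
  by (simp add: category_def)

lemma functor_obj: "is_functor C D F \<Longrightarrow> X \<in> Obj C \<Longrightarrow> FObj F X \<in> Obj D"
  by (auto simp: is_functor_def)

lemma functor_map:
  "is_functor C D F \<Longrightarrow> X \<in> Obj C \<Longrightarrow> Y \<in> Obj C \<Longrightarrow> f \<in> Hom C X Y \<Longrightarrow>
    FMap F X Y f \<in> Hom D (FObj F X) (FObj F Y)"
  by (auto simp: is_functor_def dest: PiE_mem)

lemma functor_id: "is_functor C D F \<Longrightarrow> X \<in> Obj C \<Longrightarrow> FMap F X X (Id C X) = Id D (FObj F X)"
  by (simp add: is_functor_def)

lemma functor_comp:
  "is_functor C D F \<Longrightarrow> X \<in> Obj C \<Longrightarrow> Y \<in> Obj C \<Longrightarrow> Z \<in> Obj C \<Longrightarrow>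
    f \<in> Hom C X Y \<Longrightarrow> g \<in> Hom C Y Z \<Longrightarrow>
    FMap F X Z (Comp C X Y Z g f) =
    Comp D (FObj F X) (FObj F Y) (FObj F Z) (FMap F Y Z g) (FMap F X Y f)"
  by (simp add: is_functor_def)

lemma nat_trans_component:
  "t \<in> nat_trans C D F G \<Longrightarrow> X \<in> Obj C \<Longrightarrow> t X \<in> Hom D (FObj F X) (FObj G X)"
  by (auto simp: nat_trans_def)

lemma nat_trans_natural:
  "t \<in> nat_trans C D F G \<Longrightarrow> X \<in> Obj C \<Longrightarrow> Y \<in> Obj C \<Longrightarrow> f \<in> Hom C X Y \<Longrightarrow>
    Comp D (FObj F X) (FObj F Y) (FObj G Y) (t Y) (FMap F X Y f) =
    Comp D (FObj F X) (FObj G X) (FObj G Y) (FMap G X Y f) (t X)"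
  by (auto simp: nat_trans_def)

lemma nat_trans_undefined:
  assumes "t \<in> nat_trans C D F G" "X \<notin> Obj C"
  shows "t X = undefined"
proof -
  have "t \<in> (\<Pi>\<^sub>E X\<in>Obj C. Hom D (FObj F X) (FObj G X))"
    using assms(1) unfolding nat_trans_def by blast
  from PiE_arb[OF this assms(2)] show ?thesis .
qed

lemma nat_trans_eqI:
  assumes "s \<in> nat_trans C D F G" "t \<in> nat_trans C D F' G'"
    and "\<And>X. X \<in> Obj C \<Longrightarrow> s X = t X"
  shows "s = t"
proof
  fix X
  show "s X = t X"
    by (cases "X \<in> Obj C")
      (use assms in \<open>simp_all add: nat_trans_undefined[OF assms(1)] nat_trans_undefined[OF assms(2)]\<close>)
qed

section \<open>Functor categories and full subcategories\<close>

lemma functor_category_simps [simp]: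
  "Obj (functor_category C D) = {F. is_functor C D F}"
  "Hom (functor_category C D) = nat_trans C D"
  "Id (functor_category C D) F = (\<lambda>X\<in>Obj C. Id D (FObj F X))"
  "Comp (functor_category C D) F G H t s =
    (\<lambda>X\<in>Obj C. Comp D (FObj F X) (FObj G X) (FObj H X) (t X) (s X))"
  by (simp_all add: functor_category_def)

lemma full_subcategory_simps [simp]:
  "Obj (full_subcategory C S) = Obj C \<inter> S"
  "Hom (full_subcategory C S) = Hom C"
  "Id (full_subcategory C S) = Id C"
  "Comp (full_subcategory C S) = Comp C"
  by (simp_all add: full_subcategory_def)

lemma category_full_subcategory: "category C \<Longrightarrow> category (full_subcategory C S)"
  by (simp add: category_def)

lemma nat_trans_id:
  assumes D: "category D" and F: "is_functor C D F"
  shows "(\<lambda>X\<in>Obj C. Id D (FObj F X)) \<in> nat_trans C D F F"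
  unfolding nat_trans_def
  using functor_obj[OF F] functor_map[OF F] category_id_left[OF D] category_id_right[OF D]
    category_id[OF D]
  by auto

lemma nat_trans_comp:
  assumes D: "category D" and F: "is_functor C D F" and G: "is_functor C D G"
    and H: "is_functor C D H" and s: "s \<in> nat_trans C D F G" and t: "t \<in> nat_trans C D G H"
  shows "(\<lambda>X\<in>Obj C. Comp D (FObj F X) (FObj G X) (FObj H X) (t X) (s X)) \<in> nat_trans C D F H"
  unfolding nat_trans_def
proof (intro CollectI conjI ballI)
  show "(\<lambda>X\<in>Obj C. Comp D (FObj F X) (FObj G X) (FObj H X) (t X) (s X))
      \<in> (\<Pi>\<^sub>E X\<in>Obj C. Hom D (FObj F X) (FObj H X))"
    using functor_obj[OF F] functor_obj[OF G] functor_obj[OF H]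
      nat_trans_component[OF s] nat_trans_component[OF t] category_comp[OF D] by auto
next
  fix X Y f assume X: "X \<in> Obj C" and Y: "Y \<in> Obj C" and f: "f \<in> Hom C X Y"
  note o = functor_obj[OF F X] functor_obj[OF G X] functor_obj[OF H X]
    functor_obj[OF F Y] functor_obj[OF G Y] functor_obj[OF H Y]
  note m = functor_map[OF F X Y f] functor_map[OF G X Y f] functor_map[OF H X Y f]
  note c = nat_trans_component[OF s X] nat_trans_component[OF s Y]
    nat_trans_component[OF t X] nat_trans_component[OF t Y]
  have "Comp D (FObj F X) (FObj F Y) (FObj H Y)
          (Comp D (FObj F Y) (FObj G Y) (FObj H Y) (t Y) (s Y)) (FMap F X Y f) =
        Comp D (FObj F X) (FObj G Y) (FObj H Y) (t Y)
          (Comp D (FObj F X) (FObj G X) (FObj G Y) (FMap G X Y f) (s X))"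
    using o m c by (simp add: category_assoc[OF D] nat_trans_natural[OF s X Y f])
  also have "\<dots> = Comp D (FObj F X) (FObj H X) (FObj H Y) (FMap H X Y f)
          (Comp D (FObj F X) (FObj G X) (FObj H X) (t X) (s X))"
    using o m c by (simp add: category_assoc[OF D, symmetric] nat_trans_natural[OF t X Y f])
  finally show "Comp D (FObj F X) (FObj F Y) (FObj H Y)
        ((\<lambda>X\<in>Obj C. Comp D (FObj F X) (FObj G X) (FObj H X) (t X) (s X)) Y) (FMap F X Y f) =
      Comp D (FObj F X) (FObj H X) (FObj H Y) (FMap H X Y f)
        ((\<lambda>X\<in>Obj C. Comp D (FObj F X) (FObj G X) (FObj H X) (t X) (s X)) X)"
    using X Y by simp
qed

lemma category_functor_category:
  assumes D: "category D"
  shows "category (functor_category C D)"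
  unfolding category_def functor_category_simps mem_Collect_eq
proof (intro conjI ballI, unfold mem_Collect_eq)
  fix F assume "is_functor C D F"
  then show "(\<lambda>X\<in>Obj C. Id D (FObj F X)) \<in> nat_trans C D F F"
    by (rule nat_trans_id[OF D])
next
  fix F G H s t
  assume "is_functor C D F" "is_functor C D G" "is_functor C D H"
    "s \<in> nat_trans C D F G" "t \<in> nat_trans C D G H"
  then show "(\<lambda>X\<in>Obj C. Comp D (FObj F X) (FObj G X) (FObj H X) (t X) (s X)) \<in> nat_trans C D F H"
    by (rule nat_trans_comp[OF D])
next
  fix F G t assume F: "is_functor C D F" and G: "is_functor C D G" and t: "t \<in> nat_trans C D F G"
  show "(\<lambda>X\<in>Obj C. Comp D (FObj F X) (FObj F X) (FObj G X) (t X)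
      ((\<lambda>X\<in>Obj C. Id D (FObj F X)) X)) = t"
    by (rule nat_trans_eqI[OF nat_trans_comp[OF D F F G nat_trans_id[OF D F] t] t])
      (simp add: category_id_right[OF D] functor_obj[OF F] functor_obj[OF G] nat_trans_component[OF t])
  show "(\<lambda>X\<in>Obj C. Comp D (FObj F X) (FObj G X) (FObj G X)
      ((\<lambda>X\<in>Obj C. Id D (FObj G X)) X) (t X)) = t"
    by (rule nat_trans_eqI[OF nat_trans_comp[OF D F G G t nat_trans_id[OF D G]] t])
      (simp add: category_id_left[OF D] functor_obj[OF F] functor_obj[OF G] nat_trans_component[OF t])
next
  fix F G H K s t u
  assume F: "is_functor C D F" and G: "is_functor C D G" and H: "is_functor C D H"
    and K: "is_functor C D K"
    and s: "s \<in> nat_trans C D F G" and t: "t \<in> nat_trans C D G H" and u: "u \<in> nat_trans C D H K"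
  show "(\<lambda>X\<in>Obj C. Comp D (FObj F X) (FObj G X) (FObj K X)
          ((\<lambda>X\<in>Obj C. Comp D (FObj G X) (FObj H X) (FObj K X) (u X) (t X)) X) (s X)) =
        (\<lambda>X\<in>Obj C. Comp D (FObj F X) (FObj H X) (FObj K X) (u X)
          ((\<lambda>X\<in>Obj C. Comp D (FObj F X) (FObj G X) (FObj H X) (t X) (s X)) X))"
    by (rule restrict_ext)
      (simp add: category_assoc[OF D] functor_obj[OF F] functor_obj[OF G] functor_obj[OF H]
        functor_obj[OF K] nat_trans_component[OF s] nat_trans_component[OF t]
        nat_trans_component[OF u])
qed

text \<open>Inverses chosen object by object are automatically natural: after inserting the identity
  \<open>t X\<close> after \<open>s X\<close>, naturality of \<open>t\<close> moves \<open>t\<close>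
  across the square, where \<open>s Y\<close> cancels it.\<close>

lemma isomorphism_functor_category:
  assumes D: "category D" and F: "is_functor C D F" and G: "is_functor C D G"
    and t: "t \<in> nat_trans C D F G"
    and iso: "\<And>X. X \<in> Obj C \<Longrightarrow> isomorphism D (FObj F X) (FObj G X) (t X)"
  shows "isomorphism (functor_category C D) F G t"
proof -
  have "\<exists>s. \<forall>X\<in>Obj C. s X \<in> Hom D (FObj G X) (FObj F X) \<and>
      Comp D (FObj F X) (FObj G X) (FObj F X) (s X) (t X) = Id D (FObj F X) \<and>
      Comp D (FObj G X) (FObj F X) (FObj G X) (t X) (s X) = Id D (FObj G X)"
    by (rule bchoice) (use iso in \<open>auto simp: isomorphism_def\<close>)
  then obtain s where s: "\<And>X. X \<in> Obj C \<Longrightarrow> s X \<in> Hom D (FObj G X) (FObj F X)"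
    and st: "\<And>X. X \<in> Obj C \<Longrightarrow> Comp D (FObj F X) (FObj G X) (FObj F X) (s X) (t X) = Id D (FObj F X)"
    and ts: "\<And>X. X \<in> Obj C \<Longrightarrow> Comp D (FObj G X) (FObj F X) (FObj G X) (t X) (s X) = Id D (FObj G X)"
    by blast
  define s' where "s' = restrict s (Obj C)"
  have "s' \<in> nat_trans C D G F"
    unfolding nat_trans_def
  proof (intro CollectI conjI ballI)
    show "s' \<in> (\<Pi>\<^sub>E X\<in>Obj C. Hom D (FObj G X) (FObj F X))"
      using s by (auto simp: s'_def)
  next
    fix X Y f assume X: "X \<in> Obj C" and Y: "Y \<in> Obj C" and f: "f \<in> Hom C X Y"
    note o = functor_obj[OF F X] functor_obj[OF G X] functor_obj[OF F Y] functor_obj[OF G Y]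
    note m = functor_map[OF F X Y f] functor_map[OF G X Y f]
    note c = nat_trans_component[OF t X] nat_trans_component[OF t Y] s[OF X] s[OF Y]
    note cm = category_comp[OF D]
    have "Comp D (FObj G X) (FObj G Y) (FObj F Y) (s Y) (FMap G X Y f) =
      Comp D (FObj G X) (FObj G Y) (FObj F Y) (s Y)
        (Comp D (FObj G X) (FObj G X) (FObj G Y) (FMap G X Y f)
          (Comp D (FObj G X) (FObj F X) (FObj G X) (t X) (s X)))"
      using o m c by (simp add: ts[OF X] category_id_right[OF D])
    also have "\<dots> = Comp D (FObj G X) (FObj G Y) (FObj F Y) (s Y)
        (Comp D (FObj G X) (FObj F X) (FObj G Y)
           (Comp D (FObj F X) (FObj F Y) (FObj G Y) (t Y) (FMap F X Y f)) (s X))"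
      using o m c by (simp add: category_assoc[OF D, symmetric] nat_trans_natural[OF t X Y f])
    also have "\<dots> = Comp D (FObj G X) (FObj F Y) (FObj F Y)
        (Comp D (FObj F Y) (FObj G Y) (FObj F Y) (s Y) (t Y))
        (Comp D (FObj G X) (FObj F X) (FObj F Y) (FMap F X Y f) (s X))"
      using o m c cm by (simp add: category_assoc[OF D])
    also have "\<dots> = Comp D (FObj G X) (FObj F X) (FObj F Y) (FMap F X Y f) (s X)"
      using o m c cm by (simp add: st[OF Y] category_id_left[OF D])
    finally show "Comp D (FObj G X) (FObj G Y) (FObj F Y) (s' Y) (FMap G X Y f) =
      Comp D (FObj G X) (FObj F X) (FObj F Y) (FMap F X Y f) (s' X)"
      using X Y by (simp add: s'_def)
  qed
  moreover have "(\<lambda>X\<in>Obj C. Comp D (FObj F X) (FObj G X) (FObj F X) (s' X) (t X)) =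
      (\<lambda>X\<in>Obj C. Id D (FObj F X))"
    by (rule restrict_ext) (simp add: s'_def st)
  moreover have "(\<lambda>X\<in>Obj C. Comp D (FObj G X) (FObj F X) (FObj G X) (t X) (s' X)) =
      (\<lambda>X\<in>Obj C. Id D (FObj G X))"
    by (rule restrict_ext) (simp add: s'_def ts)
  ultimately show ?thesis
    using t by (auto simp: isomorphism_def)
qed

text \<open>Choice supplies an object \<open>g A\<close> and an isomorphism \<open>e A\<close> with
  inverse \<open>d A\<close> for every \<open>A\<close>. Equations between arrows of
  \<open>C\<close> are verified after applying \<open>F\<close>, which is injective on
  hom-sets.\<close>

theorem equivalent_categories_fully_faithful:
  fixes C :: "('o, 'a) cat" and D :: "('p, 'b) cat"
  assumes C: "category C" and D: "category D" and F: "is_functor C D F"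
    and ff: "\<And>X Y. X \<in> Obj C \<Longrightarrow> Y \<in> Obj C \<Longrightarrow>
      bij_betw (FMap F X Y) (Hom C X Y) (Hom D (FObj F X) (FObj F Y))"
    and es: "\<And>A. A \<in> Obj D \<Longrightarrow> \<exists>X\<in>Obj C. \<exists>e. isomorphism D A (FObj F X) e"
  shows "equivalent_categories C D"
proof -
  let ?F = "FObj F"
  have "\<exists>g. \<forall>A\<in>Obj D. g A \<in> Obj C \<and> (\<exists>e. isomorphism D A (?F (g A)) e)"
    by (rule bchoice) (use es in blast)
  then obtain g where g [simp]: "\<And>A. A \<in> Obj D \<Longrightarrow> g A \<in> Obj C"
    and g': "\<And>A. A \<in> Obj D \<Longrightarrow> \<exists>e. isomorphism D A (?F (g A)) e"
    by blast
  have "\<exists>e. \<forall>A\<in>Obj D. isomorphism D A (?F (g A)) (e A)"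
    by (rule bchoice) (use g' in blast)
  then obtain e where e': "\<And>A. A \<in> Obj D \<Longrightarrow> isomorphism D A (?F (g A)) (e A)"
    by blast
  then have e [simp]: "\<And>A. A \<in> Obj D \<Longrightarrow> e A \<in> Hom D A (?F (g A))"
    by (simp add: isomorphism_def)
  have "\<exists>d. \<forall>A\<in>Obj D. d A \<in> Hom D (?F (g A)) A \<and>
      Comp D A (?F (g A)) A (d A) (e A) = Id D A \<and>
      Comp D (?F (g A)) A (?F (g A)) (e A) (d A) = Id D (?F (g A))"
    by (rule bchoice) (use e' in \<open>auto simp: isomorphism_def\<close>)
  then obtain d where d [simp]: "\<And>A. A \<in> Obj D \<Longrightarrow> d A \<in> Hom D (?F (g A)) A"
    and de [simp]: "\<And>A. A \<in> Obj D \<Longrightarrow> Comp D A (?F (g A)) A (d A) (e A) = Id D A"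
    and ed [simp]: "\<And>A. A \<in> Obj D \<Longrightarrow> Comp D (?F (g A)) A (?F (g A)) (e A) (d A) = Id D (?F (g A))"
    by blast
  note [simp] = functor_obj[OF F] functor_map[OF F] functor_id[OF F] functor_comp[OF F]
    category_id[OF C] category_id[OF D] category_comp[OF C] category_comp[OF D]
    category_id_left[OF C] category_id_left[OF D] category_id_right[OF C] category_id_right[OF D]
  \<comment> \<open>\<open>L X Y\<close> inverts the bijection that \<open>F\<close> induces on the
    hom-set from \<open>X\<close> to \<open>Y\<close>.\<close>
  define L where "L X Y = inv_into (Hom C X Y) (FMap F X Y)" for X Y
  have L [simp]: "L X Y h \<in> Hom C X Y" "FMap F X Y (L X Y h) = h"
    if "X \<in> Obj C" "Y \<in> Obj C" "h \<in> Hom D (?F X) (?F Y)" for X Y h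
    using ff[OF that(1,2)] that(3) unfolding L_def bij_betw_def
    by (auto intro: inv_into_into f_inv_into_f)
  have inj: "u = v" if "X \<in> Obj C" "Y \<in> Obj C" "u \<in> Hom C X Y" "v \<in> Hom C X Y"
    "FMap F X Y u = FMap F X Y v" for X Y u v
    using ff[OF that(1,2)] that(3-) by (auto simp: bij_betw_def inj_on_def)
  \<comment> \<open>Composites get bracketed to the right, which hides an adjacent pair
    \<open>e A\<close>, \<open>d A\<close> inside a longer composite; these two rules cancel it
    there.\<close>
  have cancel [simp]: "Comp D Z A (?F (g A)) (e A) (Comp D Z (?F (g A)) A (d A) h) = h"
    if "A \<in> Obj D" "Z \<in> Obj D" "h \<in> Hom D Z (?F (g A))" for A Z h
    using that by (simp add: category_assoc[OF D, symmetric])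
  have cancel' [simp]: "Comp D Z (?F (g A)) A (d A) (Comp D Z A (?F (g A)) (e A) h) = h"
    if "A \<in> Obj D" "Z \<in> Obj D" "h \<in> Hom D Z A" for A Z h
    using that by (simp add: category_assoc[OF D, symmetric])
  \<comment> \<open>Conjugation by the chosen isomorphisms turns an arrow from \<open>A\<close> to
    \<open>B\<close> into one between objects in the image of \<open>F\<close>, where
    \<open>L\<close> can be applied.\<close>
  define K where "K A B h = Comp D (?F (g A)) A (?F (g B)) (Comp D A B (?F (g B)) (e B) h) (d A)"
    for A B h
  have K [simp]: "K A B h \<in> Hom D (?F (g A)) (?F (g B))"
    if "A \<in> Obj D" "B \<in> Obj D" "h \<in> Hom D A B" for A B h
    using that by (simp add: K_def)
  define G where "G = \<lparr>FObj = restrict g (Obj D),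
    FMap = (\<lambda>A B h. if A \<in> Obj D \<and> B \<in> Obj D \<and> h \<in> Hom D A B
      then L (g A) (g B) (K A B h) else undefined)\<rparr>"
  have GO [simp]: "FObj G A = g A" if "A \<in> Obj D" for A
    using that by (simp add: G_def)
  have GM [simp]: "FMap G A B h = L (g A) (g B) (K A B h)"
    if "A \<in> Obj D" "B \<in> Obj D" "h \<in> Hom D A B" for A B h
    using that by (simp add: G_def)
  have G: "is_functor D C G"
    unfolding is_functor_def
  proof (intro conjI ballI allI impI)
    show "FObj G \<in> Obj D \<rightarrow>\<^sub>E Obj C" by (auto simp: G_def)
    show "FMap G A B \<in> Hom D A B \<rightarrow>\<^sub>E Hom C (FObj G A) (FObj G B)"
      if "A \<in> Obj D" "B \<in> Obj D" for A B
      using that by (auto simp: G_def)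
    show "FMap G A B = (\<lambda>_. undefined)" if "A \<notin> Obj D \<or> B \<notin> Obj D" for A B
      using that by (auto simp: G_def)
    show "FMap G A A (Id D A) = Id C (FObj G A)" if "A \<in> Obj D" for A
      using that by (auto intro!: inj[of "g A" "g A"] simp: K_def)
    show "FMap G A B' (Comp D A B B' k h) =
        Comp C (FObj G A) (FObj G B) (FObj G B') (FMap G B B' k) (FMap G A B h)"
      if "A \<in> Obj D" "B \<in> Obj D" "B' \<in> Obj D" "h \<in> Hom D A B" "k \<in> Hom D B B'" for A B B' h k
      using that
      by (auto intro!: inj[of "g A" "g B'"] simp: K_def category_assoc[OF D])
  qed
  have "(\<lambda>A\<in>Obj D. d A) \<in> nat_trans D D (comp_functor D F G) (id_functor D)"
    unfolding nat_trans_def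
    by (auto simp: comp_functor_def id_functor_def K_def category_assoc[OF D])
  moreover have "isomorphism D (?F (g A)) A (d A)" if "A \<in> Obj D" for A
    using that by (auto simp: isomorphism_def intro!: bexI[of _ "e A"])
  ultimately have 1: "naturally_isomorphic D D (comp_functor D F G) (id_functor D)"
    unfolding naturally_isomorphic_def
    by (intro bexI[of _ "\<lambda>A\<in>Obj D. d A"]) (auto simp: comp_functor_def id_functor_def)
  \<comment> \<open>The component at \<open>X\<close> is the unique arrow that \<open>F\<close>
    sends to \<open>d (?F X)\<close>; fullness provides it and faithfulness makes it natural and
    invertible.\<close>
  have "(\<lambda>X\<in>Obj C. L (g (?F X)) X (d (?F X))) \<in> nat_trans C C (comp_functor C G F) (id_functor C)"
    unfolding nat_trans_def
  proof (intro CollectI conjI ballI)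
    show "(\<lambda>X\<in>Obj C. L (g (?F X)) X (d (?F X))) \<in>
        (\<Pi>\<^sub>E X\<in>Obj C. Hom C (FObj (comp_functor C G F) X) (FObj (id_functor C) X))"
      by (auto simp: comp_functor_def id_functor_def)
  next
    fix X Y f assume "X \<in> Obj C" "Y \<in> Obj C" "f \<in> Hom C X Y"
    then show "Comp C (FObj (comp_functor C G F) X) (FObj (comp_functor C G F) Y)
        (FObj (id_functor C) Y) ((\<lambda>X\<in>Obj C. L (g (?F X)) X (d (?F X))) Y)
        (FMap (comp_functor C G F) X Y f) =
      Comp C (FObj (comp_functor C G F) X) (FObj (id_functor C) X) (FObj (id_functor C) Y)
        (FMap (id_functor C) X Y f) ((\<lambda>X\<in>Obj C. L (g (?F X)) X (d (?F X))) X)"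
      by (auto simp: comp_functor_def id_functor_def K_def category_assoc[OF D]
          intro!: inj[of "g (?F X)" Y])
  qed
  moreover have "isomorphism C (g (?F X)) X (L (g (?F X)) X (d (?F X)))" if "X \<in> Obj C" for X
    unfolding isomorphism_def
  proof (intro conjI bexI[of _ "L X (g (?F X)) (e (?F X))"])
    show "Comp C (g (?F X)) X (g (?F X)) (L X (g (?F X)) (e (?F X))) (L (g (?F X)) X (d (?F X))) =
        Id C (g (?F X))"
      by (rule inj[of "g (?F X)" "g (?F X)"]) (use that in simp_all)
    show "Comp C X (g (?F X)) X (L (g (?F X)) X (d (?F X))) (L X (g (?F X)) (e (?F X))) = Id C X"
      by (rule inj[of X X]) (use that in simp_all)
  qed (use that in simp_all)
  ultimately have 2: "naturally_isomorphic C C (comp_functor C G F) (id_functor C)"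
    unfolding naturally_isomorphic_def
    by (intro bexI[of _ "\<lambda>X\<in>Obj C. L (g (?F X)) X (d (?F X))"])
      (auto simp: comp_functor_def id_functor_def)
  show ?thesis
    unfolding equivalent_categories_def using C D F G 1 2 by blast
qed

section \<open>Ultrafilters and their morphisms\<close>

lemma ultrafilter_subset: "ultrafilter_on X U \<Longrightarrow> A \<in> U \<Longrightarrow> A \<subseteq> X"
  by (auto simp: ultrafilter_on_def)

lemma ultrafilter_Pow: "ultrafilter_on X U \<Longrightarrow> U \<subseteq> Pow X"
  by (simp add: ultrafilter_on_def)

lemma ultrafilter_top: "ultrafilter_on X U \<Longrightarrow> X \<in> U"
  by (simp add: ultrafilter_on_def)

lemma ultrafilter_Int_iff:
  assumes "ultrafilter_on X U" "A \<subseteq> X" "B \<subseteq> X"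
  shows "A \<inter> B \<in> U \<longleftrightarrow> A \<in> U \<and> B \<in> U"
proof -
  have "\<forall>A B. A \<subseteq> X \<and> B \<subseteq> X \<longrightarrow> (A \<inter> B \<in> U \<longleftrightarrow> A \<in> U \<and> B \<in> U)"
    using assms(1) unfolding ultrafilter_on_def by (elim conjE)
  with assms(2,3) show ?thesis by blast
qed

lemma ultrafilter_compl:
  assumes "ultrafilter_on X U" "A \<subseteq> X"
  shows "X - A \<in> U \<longleftrightarrow> A \<notin> U"
proof -
  have "\<forall>A. A \<subseteq> X \<longrightarrow> (A \<in> U \<longleftrightarrow> X - A \<notin> U)"
    using assms(1) unfolding ultrafilter_on_def by (elim conjE)
  from this[rule_format, OF assms(2)] show ?thesis by argo
qed

lemma ultrafilter_Int: "ultrafilter_on X U \<Longrightarrow> A \<in> U \<Longrightarrow> B \<in> U \<Longrightarrow> A \<inter> B \<in> U"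
  by (simp add: ultrafilter_Int_iff ultrafilter_subset)

lemma ultrafilter_mono: "ultrafilter_on X U \<Longrightarrow> A \<in> U \<Longrightarrow> A \<subseteq> B \<Longrightarrow> B \<subseteq> X \<Longrightarrow> B \<in> U"
  using ultrafilter_Int_iff[of X U A B] by (simp add: Int_absorb2 ultrafilter_subset)

lemma ultrafilter_empty: "ultrafilter_on X U \<Longrightarrow> {} \<notin> U"
  using ultrafilter_compl[of X U "{}"] ultrafilter_top by auto

lemma ultrafilter_disjoint:
  "ultrafilter_on X U \<Longrightarrow> A \<in> U \<Longrightarrow> B \<in> U \<Longrightarrow> A \<inter> B \<noteq> {}"
  using ultrafilter_Int ultrafilter_empty by metis

text \<open>If \<open>A\<close> is in \<open>V\<close>, its complement is not in \<open>V\<close>,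
  hence not in \<open>U\<close>, so \<open>A\<close> is in \<open>U\<close>. This reduces later
  identities of ultrafilters to the easier inclusion.\<close>

lemma ultrafilter_maximal:
  assumes U: "ultrafilter_on X U" and V: "ultrafilter_on X V" and "U \<subseteq> V"
  shows "U = V"
proof
  show "V \<subseteq> U"
  proof
    fix A assume A: "A \<in> V"
    then have "A \<subseteq> X" "X - A \<notin> U"
      using ultrafilter_subset[OF V] ultrafilter_compl[OF V] \<open>U \<subseteq> V\<close> by blast+
    then show "A \<in> U" using ultrafilter_compl[OF U] by blast
  qed
qed (fact assms(3))

text \<open>If the first block is not in \<open>U\<close>, its complement is, and intersecting the
  union with that complement leaves only points of the remaining blocks. This selects the block of a
  finite coproduct on which an ultrafilter lives.\<close>

lemma ultrafilter_finite_UN: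
  assumes U: "ultrafilter_on X U" and "finite I" and "\<And>i. i \<in> I \<Longrightarrow> B i \<subseteq> X"
    and "(\<Union>i\<in>I. B i) \<in> U"
  shows "\<exists>i\<in>I. B i \<in> U"
  using assms(2-)
proof (induction I rule: finite_induct)
  case empty
  then show ?case using ultrafilter_empty[OF U] by simp
next
  case (insert k I)
  show ?case
  proof (cases "B k \<in> U")
    case False
    then have "X - B k \<in> U" using ultrafilter_compl[OF U] insert.prems(1) by blast
    then have "(X - B k) \<inter> (\<Union>i\<in>insert k I. B i) \<in> U"
      using ultrafilter_Int[OF U] insert.prems(2) by blast
    then have "(\<Union>i\<in>I. B i) \<in> U"
      by (rule ultrafilter_mono[OF U]) (use insert.prems(1) in auto)
    then show ?thesis using insert by blast
  qed blast
qed

section \<open>Pushforward of ultrafilters and equality modulo an ultrafilter\<close>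

definition pushforward :: "'x set \<Rightarrow> 'y set \<Rightarrow> ('x \<Rightarrow> 'y) \<Rightarrow> 'x set set \<Rightarrow> 'y set set" where
  "pushforward X Y f U = {V. V \<subseteq> Y \<and> {x\<in>X. f x \<in> V} \<in> U}"

lemma pushforward_cong:
  assumes "\<And>x. x \<in> X \<Longrightarrow> f x = g x"
  shows "pushforward X Y f U = pushforward X Y g U"
proof -
  have "{x\<in>X. f x \<in> V} = {x\<in>X. g x \<in> V}" for V using assms by auto
  then show ?thesis by (simp add: pushforward_def)
qed

lemma pushforward_id: "U \<subseteq> Pow X \<Longrightarrow> pushforward X X (\<lambda>x. x) U = U"
  by (auto simp: pushforward_def Int_def[symmetric] Int_absorb1 intro: back_subst[of "\<lambda>A. A \<in> U"])

lemma pushforward_comp: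
  assumes f: "f \<in> X \<rightarrow> Y"
  shows "pushforward Y Z g (pushforward X Y f U) = pushforward X Z (\<lambda>x. g (f x)) U"
proof -
  have "{x\<in>X. f x \<in> {y\<in>Y. g y \<in> V}} = {x\<in>X. g (f x) \<in> V}" for V using f by auto
  then show ?thesis unfolding pushforward_def by auto
qed

lemma ultrafilter_pushforward:
  assumes U: "ultrafilter_on X U" and f: "f \<in> X \<rightarrow> Y"
  shows "ultrafilter_on Y (pushforward X Y f U)"
proof -
  have Y: "{x\<in>X. f x \<in> Y} = X" using f by auto
  have Int: "{x\<in>X. f x \<in> A \<inter> B} = {x\<in>X. f x \<in> A} \<inter> {x\<in>X. f x \<in> B}" for A B by auto
  have compl: "{x\<in>X. f x \<in> Y - A} = X - {x\<in>X. f x \<in> A}" for A using f by auto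
  show ?thesis
    unfolding ultrafilter_on_def pushforward_def mem_Collect_eq Y Int compl
    using ultrafilter_top[OF U] by (auto simp: ultrafilter_Int_iff[OF U] ultrafilter_compl[OF U])
qed

text \<open>The preimages of any set under \<open>f\<close> and \<open>g\<close> coincide on the
  agreement set, and membership in \<open>U\<close> is decided on any member of
  \<open>U\<close>.\<close>

lemma pushforward_eq_mod:
  assumes U: "ultrafilter_on X U" and "{x\<in>X. f x = g x} \<in> U"
  shows "pushforward X Y f U = pushforward X Y g U"
proof -
  have "{x\<in>X. f x \<in> V} \<in> U \<Longrightarrow> {x\<in>X. f x = g x} \<in> U \<Longrightarrow> {x\<in>X. g x \<in> V} \<in> U" for V f g
    by (drule (1) ultrafilter_Int[OF U], erule ultrafilter_mono[OF U]) auto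
  from this[of f _ g] this[of g _ f] assms(2) show ?thesis
    by (auto simp: pushforward_def eq_commute)
qed

lemma equiv_eq_mod:
  assumes U: "ultrafilter_on X U"
  shows "equiv (partial_continuous X U Y V) (eq_mod X U Y V)"
proof (rule equivI)
  show "eq_mod X U Y V \<subseteq> partial_continuous X U Y V \<times> partial_continuous X U Y V"
    by (auto simp: eq_mod_def)
  \<comment> \<open>The agreement set of \<open>f\<close> with itself is its domain, which lies in
    \<open>U\<close> by the definition of a partial continuous function.\<close>
  have "{x. \<exists>y. f x = Some y} = dom f" for f :: "'a \<rightharpoonup> 'b" by auto
  then show "refl_on (partial_continuous X U Y V) (eq_mod X U Y V)"
    by (auto simp: refl_on_def eq_mod_def partial_continuous_def)
  show "sym (eq_mod X U Y V)"
    by (auto simp: sym_def eq_mod_def conj_commute)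
  have "{x. \<exists>y. f x = Some y \<and> h x = Some y} \<in> U"
    if "{x. \<exists>y. f x = Some y \<and> g x = Some y} \<in> U" "{x. \<exists>y. g x = Some y \<and> h x = Some y} \<in> U"
      "dom f \<subseteq> X"
    for f g h :: "'a \<rightharpoonup> 'b"
    by (rule ultrafilter_mono[OF U ultrafilter_Int[OF U that(1,2)]]) (use that(3) in auto)
  moreover have "dom f \<subseteq> X" if "f \<in> partial_continuous X U Y V" for f
    using that by (simp add: partial_continuous_def)
  ultimately show "trans (eq_mod X U Y V)"
    unfolding trans_def eq_mod_def by blast
qed

text \<open>
  Every morphism of the category of ultrafilters is the class of a total function: since \<open>Y\<close>
  carries an ultrafilter it is nonempty, so a partial function can be extended arbitrarily.
\<close>

definition total_class ::
    "'x set \<Rightarrow> 'x set set \<Rightarrow> 'y set \<Rightarrow> 'y set set \<Rightarrow> ('x \<Rightarrow> 'y) \<Rightarrow> ('x \<rightharpoonup> 'y) set" where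
  "total_class X U Y V f = eq_mod X U Y V `` {(Some \<circ> f) |` X}"

text \<open>For total functions the preimage in the sense of option-valued maps is the ordinary one,
  so continuity becomes an equation: \<open>f\<close> pushes \<open>U\<close> forward to exactly
  \<open>V\<close>.\<close>

lemma total_continuous:
  assumes U: "ultrafilter_on X U" and V: "V \<subseteq> Pow Y" and f: "f \<in> X \<rightarrow> Y"
  shows "(Some \<circ> f) |` X \<in> partial_continuous X U Y V \<longleftrightarrow> pushforward X Y f U = V"
proof -
  have "((Some \<circ> f) |` X) -` (Some ` B) = {x\<in>X. f x \<in> B}" for B
    by (auto simp: restrict_map_def split: if_splits)
  moreover have "dom ((Some \<circ> f) |` X) = X" "ran ((Some \<circ> f) |` X) \<subseteq> Y"
    using f by (auto simp: restrict_map_def ran_def split: if_splits)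
  ultimately show ?thesis
    using ultrafilter_top[OF U] V by (auto simp: partial_continuous_def pushforward_def)
qed

lemma total_class_in_quotient:
  assumes U: "ultrafilter_on X U" and f: "f \<in> X \<rightarrow> Y" and V: "pushforward X Y f U = V"
  shows "total_class X U Y V f \<in> partial_continuous X U Y V // eq_mod X U Y V"
  unfolding total_class_def
  by (rule quotientI, subst total_continuous[OF U _ f]) (use V in \<open>auto simp: pushforward_def\<close>)

lemma total_class_eq_iff:
  assumes U: "ultrafilter_on X U" and f: "f \<in> X \<rightarrow> Y" and g: "g \<in> X \<rightarrow> Y"
    and Vf: "pushforward X Y f U = V" and Vg: "pushforward X Y g U = V"
  shows "total_class X U Y V f = total_class X U Y V g \<longleftrightarrow> {x\<in>X. f x = g x} \<in> U"
proof -
  have V: "V \<subseteq> Pow Y" using Vf by (auto simp: pushforward_def)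
  have "{x. \<exists>y. ((Some \<circ> f) |` X) x = Some y \<and> ((Some \<circ> g) |` X) x = Some y} = {x\<in>X. f x = g x}"
    by (auto simp: restrict_map_def split: if_splits)
  then have "((Some \<circ> f) |` X, (Some \<circ> g) |` X) \<in> eq_mod X U Y V \<longleftrightarrow> {x\<in>X. f x = g x} \<in> U"
    using total_continuous[OF U V f] total_continuous[OF U V g] Vf Vg by (simp add: eq_mod_def)
  then show ?thesis
    unfolding total_class_def
    using eq_equiv_class_iff[OF equiv_eq_mod[OF U], of "(Some \<circ> f) |` X" Y V "(Some \<circ> g) |` X"]
      total_continuous[OF U V f] total_continuous[OF U V g] Vf Vg by simp
qed

lemma total_class_surj:
  assumes U: "ultrafilter_on X U" and V: "ultrafilter_on Y V"
    and c: "c \<in> partial_continuous X U Y V // eq_mod X U Y V"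
  obtains f where "f \<in> X \<rightarrow>\<^sub>E Y" "pushforward X Y f U = V" "c = total_class X U Y V f"
proof -
  obtain p where p: "p \<in> partial_continuous X U Y V" and c: "c = eq_mod X U Y V `` {p}"
    using c by (auto elim: quotientE)
  obtain y where y: "y \<in> Y" using ultrafilter_top[OF V] ultrafilter_empty[OF V] by fastforce
  have p': "dom p \<subseteq> X" "ran p \<subseteq> Y" "dom p \<in> U" "\<And>B. B \<subseteq> Y \<Longrightarrow> B \<in> V \<longleftrightarrow> p -` (Some ` B) \<in> U"
    using p by (auto simp: partial_continuous_def)
  define f where "f = (\<lambda>x\<in>X. case p x of None \<Rightarrow> y | Some z \<Rightarrow> z)"
  have f: "f \<in> X \<rightarrow>\<^sub>E Y"
    using y by (auto simp: f_def split: option.splits intro: subsetD[OF p'(2) ranI])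
  \<comment> \<open>Outside \<open>dom p\<close> the default value \<open>y\<close> may fall into
    \<open>B\<close>, so the two preimages need not be equal; they agree on \<open>dom p\<close>,
    which is a member of \<open>U\<close>.\<close>
  have "{x\<in>X. f x \<in> B} \<in> U \<longleftrightarrow> p -` (Some ` B) \<in> U" for B
  proof
    assume "{x\<in>X. f x \<in> B} \<in> U"
    from ultrafilter_Int[OF U this p'(3)] show "p -` (Some ` B) \<in> U"
      by (rule ultrafilter_mono[OF U]) (use p'(1) in \<open>auto simp: f_def\<close>)
  next
    assume "p -` (Some ` B) \<in> U"
    then show "{x\<in>X. f x \<in> B} \<in> U"
      by (rule ultrafilter_mono[OF U]) (use p'(1) in \<open>auto simp: f_def\<close>)
  qed
  then have push: "pushforward X Y f U = V"
    using p'(4) ultrafilter_Pow[OF V] by (auto simp: pushforward_def)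
  have "{x. \<exists>y. p x = Some y \<and> ((Some \<circ> f) |` X) x = Some y} = dom p"
    using p'(1) by (auto simp: restrict_map_def f_def)
  then have "(p, (Some \<circ> f) |` X) \<in> eq_mod X U Y V"
    using p p'(3) total_continuous[OF U ultrafilter_Pow[OF V], of f] f push by (auto simp: eq_mod_def)
  then have "c = total_class X U Y V f"
    unfolding c total_class_def by (rule equiv_class_eq[OF equiv_eq_mod[OF U]])
  with f push show ?thesis by (rule that)
qed

text \<open>For representatives \<open>p\<close> and \<open>q\<close>, the composite agrees with
  \<open>g\<close> after \<open>f\<close> wherever \<open>p\<close> agrees with \<open>f\<close> and
  \<open>q\<close> agrees with \<open>g\<close> at the point \<open>f x\<close>. The second
  condition holds on a member of \<open>U\<close> precisely because \<open>f\<close> pushes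
  \<open>U\<close> to \<open>V\<close>.\<close>

lemma total_class_comp:
  assumes U: "ultrafilter_on X U" and f: "f \<in> X \<rightarrow> Y" and g: "g \<in> Y \<rightarrow> Z"
    and V: "pushforward X Y f U = V" and W: "pushforward Y Z g V = W"
  shows "(\<Union>p\<in>total_class X U Y V f. \<Union>q\<in>total_class Y V Z W g. eq_mod X U Z W `` {q \<circ>\<^sub>m p}) =
    total_class X U Z W (\<lambda>x. g (f x))"
proof -
  have V': "ultrafilter_on Y V" using ultrafilter_pushforward[OF U f] V by simp
  have W': "pushforward X Z (\<lambda>x. g (f x)) U = W" using pushforward_comp[OF f] V W by metis
  have *: "eq_mod X U Z W `` {q \<circ>\<^sub>m p} = total_class X U Z W (\<lambda>x. g (f x))"
    if p: "p \<in> total_class X U Y V f" and q: "q \<in> total_class Y V Z W g" for p q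
  proof -
    have p: "p \<in> partial_continuous X U Y V"
      and "{x. \<exists>y. ((Some \<circ> f) |` X) x = Some y \<and> p x = Some y} \<in> U"
      using p by (simp_all add: total_class_def eq_mod_def)
    from this(2) have ep: "{x\<in>X. p x = Some (f x)} \<in> U"
      by (rule ultrafilter_mono[OF U]) (auto simp: restrict_map_def split: if_splits)
    have q: "q \<in> partial_continuous Y V Z W"
      and "{y. \<exists>z. ((Some \<circ> g) |` Y) y = Some z \<and> q y = Some z} \<in> V"
      using q by (simp_all add: total_class_def eq_mod_def)
    from this(2) have eq: "{y\<in>Y. q y = Some (g y)} \<in> V"
      by (rule ultrafilter_mono[OF V']) (auto simp: restrict_map_def split: if_splits)
    have "{x\<in>X. f x \<in> {y\<in>Y. q y = Some (g y)}} \<in> U"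
      using eq V by (auto simp: pushforward_def)
    from ultrafilter_Int[OF U ep this]
    have E: "{x\<in>X. (q \<circ>\<^sub>m p) x = Some (g (f x))} \<in> U"
      by (rule ultrafilter_mono[OF U]) (auto simp: map_comp_def)
    have dom: "dom (q \<circ>\<^sub>m p) \<subseteq> X"
      using p by (auto simp: partial_continuous_def map_comp_def split: option.splits)
    have ran: "ran (q \<circ>\<^sub>m p) \<subseteq> Z"
      using q by (auto simp: partial_continuous_def map_comp_def ran_def split: option.splits)
    have "(q \<circ>\<^sub>m p) -` (Some ` B) \<in> U \<longleftrightarrow> {x\<in>X. g (f x) \<in> B} \<in> U" for B
    proof
      assume "(q \<circ>\<^sub>m p) -` (Some ` B) \<in> U"
      from ultrafilter_Int[OF U E this] show "{x\<in>X. g (f x) \<in> B} \<in> U"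
        by (rule ultrafilter_mono[OF U]) auto
    next
      assume "{x\<in>X. g (f x) \<in> B} \<in> U"
      from ultrafilter_Int[OF U E this] show "(q \<circ>\<^sub>m p) -` (Some ` B) \<in> U"
        by (rule ultrafilter_mono[OF U]) (use dom in auto)
    qed
    moreover have "dom (q \<circ>\<^sub>m p) \<in> U"
      by (rule ultrafilter_mono[OF U E]) (use dom in auto)
    ultimately have "q \<circ>\<^sub>m p \<in> partial_continuous X U Z W"
      using dom ran W' by (auto simp: partial_continuous_def pushforward_def)
    moreover have "(Some \<circ> (\<lambda>x. g (f x))) |` X \<in> partial_continuous X U Z W"
      using total_continuous[OF U, of W Z "\<lambda>x. g (f x)"] W' f g by (auto simp: pushforward_def)
    moreover have "{x. \<exists>y. (q \<circ>\<^sub>m p) x = Some y \<and> ((Some \<circ> (\<lambda>x. g (f x))) |` X) x = Some y} \<in> U"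
      by (rule ultrafilter_mono[OF U E]) (use dom in \<open>auto simp: restrict_map_def\<close>)
    ultimately have "(q \<circ>\<^sub>m p, (Some \<circ> (\<lambda>x. g (f x))) |` X) \<in> eq_mod X U Z W"
      by (simp add: eq_mod_def)
    then show ?thesis
      unfolding total_class_def by (rule equiv_class_eq[OF equiv_eq_mod[OF U]])
  qed
  \<comment> \<open>A union of equal sets is their common value only over a nonempty index set, so
    the two classes must be inhabited.\<close>
  have "total_class X U Y V f \<noteq> {}" "total_class Y V Z W g \<noteq> {}"
    using total_class_in_quotient[OF U f V] total_class_in_quotient[OF V' g W]
      in_quotient_imp_non_empty[OF equiv_eq_mod[OF U]] in_quotient_imp_non_empty[OF equiv_eq_mod[OF V']]
    by blast+
  then show ?thesis using * by auto
qed

text \<open>Injectivity makes \<open>A\<close> the preimage of its own image, so membership of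
  \<open>A\<close> in \<open>U\<close> can be read off the pushforward.\<close>

lemma pushforward_inj:
  assumes "inj_on f X" "f \<in> X \<rightarrow> Y" "U \<subseteq> Pow X" "U' \<subseteq> Pow X"
    and eq: "pushforward X Y f U = pushforward X Y f U'"
  shows "U = U'"
proof -
  have "A \<in> U \<longleftrightarrow> f ` A \<in> pushforward X Y f U" if "A \<subseteq> X" for A U
  proof -
    have "{x\<in>X. f x \<in> f ` A} = A" using assms(1) that by (auto simp: inj_on_def)
    moreover have "f ` A \<subseteq> Y" using assms(2) that by auto
    ultimately show ?thesis by (simp add: pushforward_def)
  qed
  then have "A \<in> U \<longleftrightarrow> A \<in> U'" if "A \<subseteq> X" for A using that eq by metis
  then show ?thesis using assms(3,4) by blast
qed

text \<open>Nonemptiness provides the value \<open>x0\<close> off the image of \<open>f\<close>.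
  Having a total left inverse makes injections split, and splitting is preserved by every
  functor.\<close>

lemma retraction_exists:
  assumes "inj_on f X" "X \<noteq> {}"
  obtains r where "r \<in> Y \<rightarrow>\<^sub>E X" "\<And>x. x \<in> X \<Longrightarrow> f x \<in> Y \<Longrightarrow> r (f x) = x"
proof -
  obtain x0 where x0: "x0 \<in> X" using assms(2) by blast
  define r where "r = (\<lambda>y\<in>Y. if y \<in> f ` X then inv_into X f y else x0)"
  show ?thesis
  proof (rule that)
    show "r \<in> Y \<rightarrow>\<^sub>E X" using x0 assms(1) by (auto simp: r_def)
    show "r (f x) = x" if "x \<in> X" "f x \<in> Y" for x
      using that assms(1) by (simp add: r_def)
  qed
qed

section \<open>Small sets and coproducts of sets\<close>

lemma Set_category_simps [simp]:
  "Obj (Set_category elts) = UNIV"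
  "Hom (Set_category elts) X Y = elts X \<rightarrow>\<^sub>E elts Y"
  "Id (Set_category elts) X = (\<lambda>x\<in>elts X. x)"
  "Comp (Set_category elts) X Y Z g f = compose (elts X) g f"
  by (simp_all add: Set_category_def)

lemma compose_PiE: "f \<in> A \<rightarrow>\<^sub>E B \<Longrightarrow> g \<in> B \<rightarrow>\<^sub>E C \<Longrightarrow> compose A g f \<in> A \<rightarrow>\<^sub>E C"
  by (auto simp: compose_def)

lemma category_Set: "category (Set_category elts)"
  unfolding category_def
proof (intro conjI ballI)
  fix X Y f assume f: "f \<in> Hom (Set_category elts) X Y"
  show "Comp (Set_category elts) X X Y f (Id (Set_category elts) X) = f"
    "Comp (Set_category elts) X Y Y (Id (Set_category elts) Y) f = f"
    using f by (auto simp: fun_eq_iff compose_def PiE_arb[of f "elts X"])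
qed (auto simp: compose_def fun_eq_iff)

lemma isomorphism_Set:
  assumes "f \<in> elts X \<rightarrow>\<^sub>E elts Y" "bij_betw f (elts X) (elts Y)"
  shows "isomorphism (Set_category elts) X Y f"
proof -
  define g where "g = restrict (inv_into (elts X) f) (elts Y)"
  have "g \<in> elts Y \<rightarrow>\<^sub>E elts X"
    using assms(2) by (auto simp: g_def bij_betw_def intro: inv_into_into)
  moreover have "compose (elts X) g f = (\<lambda>x\<in>elts X. x)"
    using assms by (auto simp: compose_def g_def bij_betw_inv_into_left intro!: restrict_ext)
  moreover have "compose (elts Y) f g = (\<lambda>x\<in>elts Y. x)"
    using assms by (auto simp: compose_def g_def bij_betw_inv_into_right intro!: restrict_ext)
  ultimately show ?thesis using assms(1) by (auto simp: isomorphism_def)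
qed

lemma ex1_unique: "\<exists>!x. P x \<Longrightarrow> P a \<Longrightarrow> P b \<Longrightarrow> a = b"
  by blast

context set_universe
begin

abbreviation Sets :: "('v, 'v \<Rightarrow> 'v) cat" where "Sets \<equiv> Set_category elts"

section \<open>Small sets, ordered pairs and codes for ultrafilters\<close>

definition small :: "'v set \<Rightarrow> bool" where "small B \<longleftrightarrow> (\<exists>y. elts y = B)"

definition setof :: "'v set \<Rightarrow> 'v" where "setof B = (SOME y. elts y = B)"

lemma elts_setof: "small B \<Longrightarrow> elts (setof B) = B"
  unfolding small_def setof_def by (rule someI_ex)

lemma small_elts: "small (elts x)" by (auto simp: small_def)

lemma setof_elts [simp]: "setof (elts x) = x"
  by (rule extensionality) (rule elts_setof[OF small_elts])

lemma small_subset: "small B \<Longrightarrow> A \<subseteq> B \<Longrightarrow> small A"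
  unfolding small_def using separation by blast

lemma elts_setof_subset [simp]: "A \<subseteq> elts X \<Longrightarrow> elts (setof A) = A"
  by (rule elts_setof[OF small_subset[OF small_elts]])

lemma small_image: "small B \<Longrightarrow> small (f ` B)"
  unfolding small_def using replacement by blast

text \<open>The union axiom speaks of the members of one element of the universe, so the family is
  first collected into such an element by replacement along \<open>setof\<close>.\<close>

lemma small_UN:
  assumes "small A" "\<And>a. a \<in> A \<Longrightarrow> small (B a)"
  shows "small (\<Union>a\<in>A. B a)"
proof -
  have "small ((\<lambda>a. setof (B a)) ` A)" by (rule small_image[OF assms(1)])
  then obtain y where y: "elts y = (\<lambda>a. setof (B a)) ` A" by (auto simp: small_def)
  have "\<Union> (elts ` elts y) = (\<Union>a\<in>A. B a)"
    using elts_setof[OF assms(2)] by (auto simp: y)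
  then show ?thesis using union[of y] by (auto simp: small_def)
qed

lemma small_small_subsets:
  assumes "small B"
  shows "small {z. elts z \<subseteq> B}"
  using assms power_set by (auto simp: small_def)

lemma small_empty: "small {}"
  using small_subset[OF small_elts] by blast

lemma setof_eqI: "elts z = B \<Longrightarrow> z = setof B"
  by auto

lemma subset_singleton_sets:
  "{z. elts z \<subseteq> {}} = {setof {}}" "small {a} \<Longrightarrow> {z. elts z \<subseteq> {a}} = {setof {}, setof {a}}"
proof -
  show "{z. elts z \<subseteq> {}} = {setof {}}"
    by (auto simp: elts_setof[OF small_empty] intro: setof_eqI)
  assume a: "small {a}"
  show "{z. elts z \<subseteq> {a}} = {setof {}, setof {a}}"
    by (auto simp: elts_setof[OF small_empty] elts_setof[OF a] subset_singleton_iff dest: setof_eqI)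
qed

lemma small_singleton_empty: "small {setof {}}"
  using small_small_subsets[OF small_empty] by (simp only: subset_singleton_sets(1))

lemma empty_neq_singleton: "setof {} \<noteq> setof {setof {}}"
  using elts_setof[OF small_empty] elts_setof[OF small_singleton_empty] by (metis insert_not_empty)

text \<open>Pairing is derived: the second power set of the empty set has two distinct members, and
  replacement maps it onto any given pair.\<close>

lemma small_doubleton: "small {a, b}"
proof -
  have "small {setof {}, setof {setof {}}}"
    using small_small_subsets[OF small_singleton_empty]
    by (simp only: subset_singleton_sets(2)[OF small_singleton_empty])
  from small_image[OF this, of "\<lambda>z. if z = setof {} then a else b"] show ?thesis
    using empty_neq_singleton by (simp add: insert_commute)
qed

lemma small_singleton: "small {a}"
  using small_doubleton[of a a] by simp

lemma setof_eq_iff: "small A \<Longrightarrow> small B \<Longrightarrow> setof A = setof B \<longleftrightarrow> A = B"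
  using elts_setof by metis

text \<open>The Kuratowski pair.\<close>

definition opair :: "'v \<Rightarrow> 'v \<Rightarrow> 'v" where
  "opair a b = setof {setof {a}, setof {a, b}}"

lemma opair_eq_iff [simp]: "opair a b = opair c d \<longleftrightarrow> a = c \<and> b = d"
  unfolding opair_def by (auto simp: setof_eq_iff small_doubleton small_singleton doubleton_eq_iff)

text \<open>
  Ultrafilters are not themselves elements of the universe, so they are coded as its elements.
\<close>

definition ucode :: "'v set set \<Rightarrow> 'v" where "ucode U = setof (setof ` U)"

text \<open>All codes of families of subsets of \<open>X\<close> lie in the double power set of
  \<open>X\<close>. This bound does not depend on the family, which is what makes a sum over all
  ultrafilters small.\<close>

lemma ucode_bounded:
  assumes "U \<subseteq> Pow (elts X)"
  shows "small (setof ` U)" and "ucode U \<in> {w. elts w \<subseteq> {z. elts z \<subseteq> elts X}}"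
proof -
  have "elts (setof A) \<subseteq> elts X" if "A \<in> U" for A
    using elts_setof_subset[OF PowD[OF subsetD[OF assms that]]] that assms by auto
  then have sub: "setof ` U \<subseteq> {z. elts z \<subseteq> elts X}" by auto
  then show "small (setof ` U)"
    by (rule small_subset[OF small_small_subsets[OF small_elts]])
  then show "ucode U \<in> {w. elts w \<subseteq> {z. elts z \<subseteq> elts X}}"
    using sub by (simp add: ucode_def elts_setof)
qed

lemma elts_image_setof:
  assumes "U \<subseteq> Pow (elts X)"
  shows "elts ` setof ` U = U"
proof -
  have "elts (setof A) = A" if "A \<in> U" for A
    using elts_setof_subset[OF PowD[OF subsetD[OF assms that]]] that assms by auto
  then show ?thesis by (simp add: image_image)
qed

lemma ucode_inject:
  assumes "U \<subseteq> Pow (elts X)" "V \<subseteq> Pow (elts Y)"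
  shows "ucode U = ucode V \<longleftrightarrow> U = V"
proof
  assume "ucode U = ucode V"
  then have "setof ` U = setof ` V"
    using ucode_bounded(1)[OF assms(1)] ucode_bounded(1)[OF assms(2)]
    by (simp add: ucode_def setof_eq_iff)
  then have "elts ` setof ` U = elts ` setof ` V" by simp
  then show "U = V" unfolding elts_image_setof[OF assms(1)] elts_image_setof[OF assms(2)] .
qed simp

section \<open>Coproducts of sets are disjoint unions\<close>

lemma coproduct_Set_iff:
  "is_coproduct Sets I A P j \<longleftrightarrow>
    (\<forall>i\<in>I. j i \<in> elts (A i) \<rightarrow>\<^sub>E elts P) \<and>
    bij_betw (\<lambda>(i, a). j i a) (SIGMA i:I. elts (A i)) (elts P)" (is "?L \<longleftrightarrow> ?R")
proof
  assume cop: ?L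
  then have j: "\<forall>i\<in>I. j i \<in> elts (A i) \<rightarrow>\<^sub>E elts P" by (simp add: is_coproduct_def)
  \<comment> \<open>A two-element set suffices as test object: uniqueness of mediating maps into it
    gives joint surjectivity of the injections, existence gives joint injectivity.\<close>
  define o0 o1 where "o0 = setof {}" and "o1 = setof {setof {}}"
  have ne: "o0 \<noteq> o1" unfolding o0_def o1_def by (rule empty_neq_singleton)
  define T where "T = setof {o0, o1}"
  have T: "elts T = {o0, o1}" by (simp add: T_def elts_setof small_doubleton)
  have univ: "\<exists>!h. h \<in> elts P \<rightarrow>\<^sub>E elts T \<and> (\<forall>i\<in>I. compose (elts (A i)) h (j i) = g i)"
    if "\<forall>i\<in>I. g i \<in> elts (A i) \<rightarrow>\<^sub>E elts T" for g
    using cop that by (simp add: is_coproduct_def)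
  have "\<exists>i\<in>I. \<exists>a\<in>elts (A i). j i a = p" if p: "p \<in> elts P" for p
  proof (rule ccontr)
    assume neg: "\<not> (\<exists>i\<in>I. \<exists>a\<in>elts (A i). j i a = p)"
    \<comment> \<open>The two maps differ only at the point \<open>p\<close>, which no
      \<open>j i\<close> reaches, so both mediate for the constant family.\<close>
    define h0 h1 where "h0 = (\<lambda>q\<in>elts P. o0)" and "h1 = (\<lambda>q\<in>elts P. if q = p then o1 else o0)"
    have "\<forall>i\<in>I. (\<lambda>a\<in>elts (A i). o0) \<in> elts (A i) \<rightarrow>\<^sub>E elts T" by (simp add: T)
    then have "h0 = h1"
    proof (rule ex1_unique[OF univ])
      have "h0 (j i a) = o0" "h1 (j i a) = o0" if "i \<in> I" "a \<in> elts (A i)" for i a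
        using that neg PiE_mem[OF bspec[OF j that(1)] that(2)] by (auto simp: h0_def h1_def)
      then show "h0 \<in> elts P \<rightarrow>\<^sub>E elts T \<and>
          (\<forall>i\<in>I. compose (elts (A i)) h0 (j i) = (\<lambda>a\<in>elts (A i). o0))"
        "h1 \<in> elts P \<rightarrow>\<^sub>E elts T \<and>
          (\<forall>i\<in>I. compose (elts (A i)) h1 (j i) = (\<lambda>a\<in>elts (A i). o0))"
        by (auto simp: T compose_def h0_def h1_def intro!: restrict_ext)
    qed
    then have "h0 p = h1 p" by simp
    then show False using p ne by (simp add: h0_def h1_def)
  qed
  moreover have "inj_on (\<lambda>(i, a). j i a) (SIGMA i:I. elts (A i))"
  proof (rule inj_onI, clarify)
    fix i a k b assume i: "i \<in> I" "a \<in> elts (A i)" and k: "k \<in> I" "b \<in> elts (A k)"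
      and eq: "j i a = j k b"
    \<comment> \<open>The indicator of the single point \<open>a\<close> in block \<open>i\<close>;
      the mediating map carries it to \<open>P\<close> and separates \<open>j i a\<close> from the
      image of every other point.\<close>
    define g where "g l = (\<lambda>c\<in>elts (A l). if l = i \<and> c = a then o1 else o0)" for l
    have "\<forall>l\<in>I. g l \<in> elts (A l) \<rightarrow>\<^sub>E elts T" by (auto simp: g_def T)
    from ex1_implies_ex[OF univ[OF this]] obtain h
      where h: "\<And>l. l \<in> I \<Longrightarrow> compose (elts (A l)) h (j l) = g l" by blast
    have "h (j i a) = g i a" "h (j k b) = g k b"
      using fun_cong[OF h[OF i(1)], of a] fun_cong[OF h[OF k(1)], of b] i k
      by (simp_all add: compose_def)
    then have "g k b = g i a" by (simp only: eq)
    moreover have "g i a = o1" "g k b = (if k = i \<and> b = a then o1 else o0)"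
      using i k by (auto simp: g_def)
    ultimately show "i = k \<and> a = b" using ne by metis
  qed
  ultimately show ?R using j by (force simp: bij_betw_def)
next
  assume R: ?R
  then have j: "\<And>i. i \<in> I \<Longrightarrow> j i \<in> elts (A i) \<rightarrow>\<^sub>E elts P"
    and bij: "bij_betw (\<lambda>(i, a). j i a) (SIGMA i:I. elts (A i)) (elts P)" by auto
  have surj: "\<exists>i a. i \<in> I \<and> a \<in> elts (A i) \<and> p = j i a" if "p \<in> elts P" for p
    using bij that by (force simp: bij_betw_def)
  have "\<exists>!h. h \<in> elts P \<rightarrow>\<^sub>E elts Q \<and> (\<forall>i\<in>I. compose (elts (A i)) h (j i) = g i)"
    if g: "\<And>i. i \<in> I \<Longrightarrow> g i \<in> elts (A i) \<rightarrow>\<^sub>E elts Q" for Q g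
  proof (rule ex1I)
    define r where "r = inv_into (SIGMA i:I. elts (A i)) (\<lambda>(i, a). j i a)"
    define h where "h = (\<lambda>p\<in>elts P. case r p of (i, a) \<Rightarrow> g i a)"
    have r: "r (j i a) = (i, a)" if "i \<in> I" "a \<in> elts (A i)" for i a
      using bij_betw_inv_into_left[OF bij, of "(i, a)"] that by (simp add: r_def)
    have hj: "h (j i a) = g i a" if "i \<in> I" "a \<in> elts (A i)" for i a
      using that j[OF that(1)] by (auto simp: h_def r)
    have "h p \<in> elts Q" if "p \<in> elts P" for p
      using surj[OF that] g by (force simp: hj)
    then have "h \<in> elts P \<rightarrow>\<^sub>E elts Q" by (auto simp: h_def)
    moreover have "compose (elts (A i)) h (j i) = g i" if "i \<in> I" for i
      using g[OF that] PiE_arb[OF g[OF that]] by (auto simp: compose_def hj that intro!: ext)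
    ultimately show "h \<in> elts P \<rightarrow>\<^sub>E elts Q \<and> (\<forall>i\<in>I. compose (elts (A i)) h (j i) = g i)" by blast
    fix k assume k: "k \<in> elts P \<rightarrow>\<^sub>E elts Q \<and> (\<forall>i\<in>I. compose (elts (A i)) k (j i) = g i)"
    have "k (j i a) = g i a" if "i \<in> I" "a \<in> elts (A i)" for i a
      using conjunct2[OF k, rule_format, OF that(1), THEN fun_cong, of a] that
      by (simp add: compose_def)
    then have "k p = h p" if "p \<in> elts P" for p
      using surj[OF that] hj by auto
    then show "k = h"
      using k \<open>h \<in> elts P \<rightarrow>\<^sub>E elts Q\<close> by (intro PiE_ext[of k "elts P" "\<lambda>_. elts Q" h]) auto
  qed
  then show ?L using j by (simp add: is_coproduct_def)
qed

section \<open>The ultrafilter of an element\<close>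

abbreviation UF :: "('v \<times> 'v set set, ('v \<rightharpoonup> 'v) set) cat" where "UF \<equiv> UF_category elts"

abbreviation arrow :: "'v \<Rightarrow> 'v set set \<Rightarrow> 'v \<Rightarrow> 'v set set \<Rightarrow> ('v \<Rightarrow> 'v) \<Rightarrow> ('v \<rightharpoonup> 'v) set" where
  "arrow X U Y V \<equiv> total_class (elts X) U (elts Y) V"

lemma UF_Obj [simp]: "(X, U) \<in> Obj UF \<longleftrightarrow> ultrafilter_on (elts X) U"
  by (simp add: UF_category_def)

lemma UF_Id: "Id UF (X, U) = arrow X U X U (\<lambda>x\<in>elts X. x)"
proof -
  have "(Some \<circ> (\<lambda>x\<in>elts X. x)) |` elts X = Some |` elts X"
    by (auto simp: restrict_map_def)
  then show ?thesis by (simp add: UF_category_def total_class_def)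
qed

lemma arrow_in_Hom:
  assumes "ultrafilter_on (elts X) U" "f \<in> elts X \<rightarrow>\<^sub>E elts Y"
    "pushforward (elts X) (elts Y) f U = V"
  shows "arrow X U Y V f \<in> Hom UF (X, U) (Y, V)"
  using total_class_in_quotient[OF assms(1) _ assms(3)] assms(2) by (auto simp: UF_category_def)

lemma arrow_cases:
  assumes "ultrafilter_on (elts X) U" "ultrafilter_on (elts Y) V" "c \<in> Hom UF (X, U) (Y, V)"
  obtains f where "f \<in> elts X \<rightarrow>\<^sub>E elts Y" "pushforward (elts X) (elts Y) f U = V"
    "c = arrow X U Y V f"
  using total_class_surj[OF assms(1,2), of c] assms(3) by (auto simp: UF_category_def)

lemma arrow_comp:
  assumes U: "ultrafilter_on (elts X) U" and f: "f \<in> elts X \<rightarrow>\<^sub>E elts Y" and g: "g \<in> elts Y \<rightarrow>\<^sub>E elts Z"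
    and V: "pushforward (elts X) (elts Y) f U = V" and W: "pushforward (elts Y) (elts Z) g V = W"
  shows "Comp UF (X, U) (Y, V) (Z, W) (arrow Y V Z W g) (arrow X U Y V f) =
    arrow X U Z W (compose (elts X) g f)"
proof -
  have "(Some \<circ> (\<lambda>x. g (f x))) |` elts X = (Some \<circ> compose (elts X) g f) |` elts X"
    by (auto simp: restrict_map_def compose_def)
  then show ?thesis
    using total_class_comp[OF U _ _ V W] f g by (simp add: UF_category_def total_class_def PiE_def)
qed

lemma pushforward_compose:
  assumes "f \<in> X \<rightarrow>\<^sub>E Y" "pushforward X Y f U = V" "pushforward Y Z g V = W"
  shows "pushforward X Z (compose X g f) U = W"
proof -
  have "pushforward X Z (compose X g f) U = pushforward X Z (\<lambda>x. g (f x)) U"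
    by (rule pushforward_cong) (simp add: compose_def)
  then show ?thesis using pushforward_comp[of f X Y Z g U] assms by (simp add: PiE_def)
qed

section \<open>Set-valued functors and transformations, element by element\<close>

lemma set_functor_map:
  "is_functor C Sets F \<Longrightarrow> X \<in> Obj C \<Longrightarrow> Y \<in> Obj C \<Longrightarrow> f \<in> Hom C X Y \<Longrightarrow>
    x \<in> elts (FObj F X) \<Longrightarrow> FMap F X Y f x \<in> elts (FObj F Y)"
  using functor_map[of C Sets F X Y f] by auto

lemma set_functor_comp:
  "is_functor C Sets F \<Longrightarrow> X \<in> Obj C \<Longrightarrow> Y \<in> Obj C \<Longrightarrow> Z \<in> Obj C \<Longrightarrow>
    f \<in> Hom C X Y \<Longrightarrow> g \<in> Hom C Y Z \<Longrightarrow> x \<in> elts (FObj F X) \<Longrightarrow>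
    FMap F Y Z g (FMap F X Y f x) = FMap F X Z (Comp C X Y Z g f) x"
  by (simp add: functor_comp compose_def)

lemma set_functor_id:
  "is_functor C Sets F \<Longrightarrow> X \<in> Obj C \<Longrightarrow> x \<in> elts (FObj F X) \<Longrightarrow> FMap F X X (Id C X) x = x"
  by (simp add: functor_id)

lemma nat_trans_Set:
  "t \<in> nat_trans C Sets F G \<Longrightarrow> X \<in> Obj C \<Longrightarrow> x \<in> elts (FObj F X) \<Longrightarrow>
    t X x \<in> elts (FObj G X)"
  using nat_trans_component[of t C Sets F G X] by auto

lemma nat_trans_Set_natural:
  assumes "t \<in> nat_trans C Sets F G" "X \<in> Obj C" "Y \<in> Obj C" "f \<in> Hom C X Y" "x \<in> elts (FObj F X)"
  shows "t Y (FMap F X Y f x) = FMap G X Y f (t X x)"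
  using fun_cong[OF nat_trans_natural[OF assms(1-4)], of x] assms(5) by (simp add: compose_def)

lemma nat_trans_SetI:
  assumes "is_functor C Sets F" "is_functor C Sets G"
    and "\<And>X. X \<in> Obj C \<Longrightarrow> t X \<in> elts (FObj F X) \<rightarrow>\<^sub>E elts (FObj G X)"
    and "\<And>X. X \<notin> Obj C \<Longrightarrow> t X = undefined"
    and "\<And>X Y f x. X \<in> Obj C \<Longrightarrow> Y \<in> Obj C \<Longrightarrow> f \<in> Hom C X Y \<Longrightarrow> x \<in> elts (FObj F X) \<Longrightarrow>
      t Y (FMap F X Y f x) = FMap G X Y f (t X x)"
  shows "t \<in> nat_trans C Sets F G"
  unfolding nat_trans_def using assms(3-)
  by (auto simp: compose_def intro!: PiE_I restrict_ext)

section \<open>The support of an element\<close>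

definition support :: "('v, 'v \<Rightarrow> 'v, 'v, 'v \<Rightarrow> 'v) fctr \<Rightarrow> 'v \<Rightarrow> 'v \<Rightarrow> 'v set set" where
  "support F X x =
    {A. A \<subseteq> elts X \<and> x \<in> FMap F (setof A) X (\<lambda>a\<in>A. a) ` elts (FObj F (setof A))}"

lemma inclusion_PiE: "A \<subseteq> elts X \<Longrightarrow> (\<lambda>a\<in>A. a) \<in> elts (setof A) \<rightarrow>\<^sub>E elts X"
  by auto

text \<open>The restriction of \<open>f\<close> to \<open>A\<close> factors through
  \<open>B\<close>, and \<open>F\<close> preserves the resulting commutative square. Leaving
  \<open>B\<close> free, instead of taking the image of \<open>A\<close>, lets one lemma serve for
  monotonicity, for intersections and for pushforwards.\<close>

lemma support_image:
  assumes F: "is_functor Sets Sets F" and f: "f \<in> elts X \<rightarrow>\<^sub>E elts Y"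
    and A: "A \<in> support F X x" and B: "B \<subseteq> elts Y" "\<And>a. a \<in> A \<Longrightarrow> f a \<in> B"
  shows "B \<in> support F Y (FMap F X Y f x)"
proof -
  obtain a where A: "A \<subseteq> elts X" and a: "a \<in> elts (FObj F (setof A))"
    and x: "x = FMap F (setof A) X (\<lambda>a\<in>A. a) a"
    using A by (auto simp: support_def)
  let ?f = "restrict f A"
  have f': "?f \<in> elts (setof A) \<rightarrow>\<^sub>E elts (setof B)" using A B by auto
  have "compose (elts (setof A)) f (\<lambda>a\<in>A. a) = ?f" "compose (elts (setof A)) (\<lambda>b\<in>B. b) ?f = ?f"
    using A B by (auto simp: compose_def intro!: restrict_ext)
  then have "FMap F X Y f x = FMap F (setof B) Y (\<lambda>b\<in>B. b) (FMap F (setof A) (setof B) ?f a)"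
    using f f' inclusion_PiE[OF A] inclusion_PiE[OF B(1)] a
    by (simp add: x set_functor_comp[OF F])
  moreover have "FMap F (setof A) (setof B) ?f a \<in> elts (FObj F (setof B))"
    using set_functor_map[OF F, of "setof A" "setof B" ?f] f' a by simp
  ultimately show ?thesis using B(1) by (auto simp: support_def)
qed

lemma support_mono:
  assumes F: "is_functor Sets Sets F" and x: "x \<in> elts (FObj F X)"
    and "A \<in> support F X x" "A \<subseteq> B" "B \<subseteq> elts X"
  shows "B \<in> support F X x"
  using support_image[OF F, of "\<lambda>x\<in>elts X. x" X X A x B] set_functor_id[OF F _ x] assms(3-)
  by (auto simp: subset_iff)

text \<open>\<open>f\<close> and \<open>g\<close> have the same composite with the inclusion of
  their agreement set, and \<open>x\<close> comes from there. This is why the action on stalks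
  depends only on the class of a function.\<close>

lemma support_eqI:
  assumes F: "is_functor Sets Sets F" and f: "f \<in> elts X \<rightarrow>\<^sub>E elts Y" and g: "g \<in> elts X \<rightarrow>\<^sub>E elts Y"
    and A: "{a\<in>elts X. f a = g a} \<in> support F X x"
  shows "FMap F X Y f x = FMap F X Y g x"
proof -
  let ?A = "{a\<in>elts X. f a = g a}"
  have sub: "?A \<subseteq> elts X" by blast
  obtain a where a: "a \<in> elts (FObj F (setof ?A))" and x: "x = FMap F (setof ?A) X (\<lambda>a\<in>?A. a) a"
    using A by (auto simp: support_def)
  have "compose (elts (setof ?A)) f (\<lambda>a\<in>?A. a) = compose (elts (setof ?A)) g (\<lambda>a\<in>?A. a)"
    by (auto simp: compose_def elts_setof_subset[OF sub] intro!: restrict_ext)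
  then show ?thesis
    using f g inclusion_PiE[OF sub] a
    by (simp add: x set_functor_comp[OF F])
qed

lemma preserves_finite_coproductsD:
  fixes I :: "nat set"
  assumes "preserves_finite_coproducts C D F" "finite I" "is_coproduct C I A P j"
  shows "is_coproduct D I (\<lambda>i. FObj F (A i)) (FObj F P) (\<lambda>i. FMap F (A i) P (j i))"
  using assms(1)[unfolded preserves_finite_coproducts_def, rule_format, OF conjI[OF assms(2,3)]] .

text \<open>\<open>F\<close> turns the decomposition of \<open>X\<close> into \<open>A\<close> and
  its complement into a disjoint union, so \<open>x\<close> has a preimage in exactly one of the two
  values.\<close>

lemma support_compl:
  assumes F: "preserves_finite_coproducts Sets Sets F"
    and x: "x \<in> elts (FObj F X)" and A: "A \<subseteq> elts X"
  shows "elts X - A \<in> support F X x \<longleftrightarrow> A \<notin> support F X x"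
proof -
  \<comment> \<open>Preservation is formulated for index sets of natural numbers, so the two blocks
    are numbered 0 and 1.\<close>
  define B where "B i = (if i = 0 then A else elts X - A)" for i :: nat
  have B: "B i \<subseteq> elts X" for i using A by (auto simp: B_def)
  have "is_coproduct Sets {0, 1::nat} (\<lambda>i. setof (B i)) X (\<lambda>i. \<lambda>a\<in>B i. a)"
    unfolding coproduct_Set_iff
  proof (intro conjI ballI)
    show "(\<lambda>a\<in>B i. a) \<in> elts (setof (B i)) \<rightarrow>\<^sub>E elts X" for i
      by (rule inclusion_PiE[OF B])
    show "bij_betw (\<lambda>(i, a). (\<lambda>a\<in>B i. a) a) (SIGMA i:{0, 1}. elts (setof (B i))) (elts X)"
      unfolding elts_setof_subset[OF B]
    proof (rule bij_betwI')
      show "\<exists>q\<in>SIGMA i:{0, 1}. B i. p = (\<lambda>(i, a). (\<lambda>a\<in>B i. a) a) q" if "p \<in> elts X" for p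
        using that by (intro bexI[of _ "(if p \<in> A then 0 else 1, p)"]) (auto simp: B_def)
    qed (use A in \<open>auto simp: B_def split: if_splits\<close>)
  qed
  from preserves_finite_coproductsD[OF F _ this]
  have bij: "bij_betw (\<lambda>(i, a). FMap F (setof (B i)) X (\<lambda>a\<in>B i. a) a)
      (SIGMA i:{0, 1}. elts (FObj F (setof (B i)))) (elts (FObj F X))"
    unfolding coproduct_Set_iff by simp
  let ?j = "\<lambda>i. FMap F (setof (B i)) X (\<lambda>a\<in>B i. a)"
  have S: "B i \<in> support F X x \<longleftrightarrow> (\<exists>a\<in>elts (FObj F (setof (B i))). x = ?j i a)" for i
    using B by (auto simp: support_def)
  have "x \<in> (\<lambda>(i, a). ?j i a) ` (SIGMA i:{0, 1}. elts (FObj F (setof (B i))))"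
    using x by (simp only: bij_betw_imp_surj_on[OF bij])
  then obtain i a where "i \<in> {0, 1}" "a \<in> elts (FObj F (setof (B i)))" "x = ?j i a"
    by (elim imageE SigmaE) simp
  then have "B 0 \<in> support F X x \<or> B 1 \<in> support F X x" using S by blast
  moreover have "\<not> (B 0 \<in> support F X x \<and> B 1 \<in> support F X x)"
  proof
    assume "B 0 \<in> support F X x \<and> B 1 \<in> support F X x"
    then obtain a b where "a \<in> elts (FObj F (setof (B 0)))" "b \<in> elts (FObj F (setof (B 1)))"
      "?j 0 a = ?j 1 b" using S by metis
    then show False
      using bij_betw_imp_inj_on[OF bij, THEN inj_onD, of "(0, a)" "(1, b)"] by simp
  qed
  ultimately show ?thesis by (auto simp: B_def)
qed

lemma ultrafilter_support:
  assumes F: "is_functor Sets Sets F" and FC: "preserves_finite_coproducts Sets Sets F"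
    and x: "x \<in> elts (FObj F X)"
  shows "ultrafilter_on (elts X) (support F X x)"
  unfolding ultrafilter_on_def
proof (intro conjI allI impI)
  show "support F X x \<subseteq> Pow (elts X)" by (auto simp: support_def)
  show "elts X \<in> support F X x"
    using set_functor_id[OF F _ x] x by (auto simp: support_def image_iff intro!: bexI[of _ x])
  show "A \<in> support F X x \<longleftrightarrow> elts X - A \<notin> support F X x" if "A \<subseteq> elts X" for A
    using support_compl[OF FC x that] by blast
  fix A B assume AB: "A \<subseteq> elts X \<and> B \<subseteq> elts X"
  show "A \<inter> B \<in> support F X x \<longleftrightarrow> A \<in> support F X x \<and> B \<in> support F X x"
  proof
    assume "A \<inter> B \<in> support F X x"
    then show "A \<in> support F X x \<and> B \<in> support F X x"
      using support_mono[OF F x, of "A \<inter> B" A] support_mono[OF F x, of "A \<inter> B" B] AB by blast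
  next
    assume supp: "A \<in> support F X x \<and> B \<in> support F X x"
    \<comment> \<open>If \<open>A \<inter> B\<close> did not support \<open>x\<close>, it would not
      support the preimage \<open>a\<close> either. The complement law inside \<open>A\<close> then
      makes \<open>A - A \<inter> B\<close> support \<open>a\<close>; pushed into \<open>X\<close>,
      this makes the complement of \<open>B\<close> support \<open>x\<close>, although
      \<open>B\<close> does.\<close>
    then obtain a where a: "a \<in> elts (FObj F (setof A))" and xa: "x = FMap F (setof A) X (\<lambda>a\<in>A. a) a"
      by (auto simp: support_def)
    have eA: "elts (setof A) = A" using AB by (intro elts_setof_subset[of A X]) blast
    have i: "(\<lambda>a\<in>A. a) \<in> elts (setof A) \<rightarrow>\<^sub>E elts X" using AB by (intro inclusion_PiE) blast
    show "A \<inter> B \<in> support F X x"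
    proof (rule ccontr)
      assume "A \<inter> B \<notin> support F X x"
      then have "A \<inter> B \<notin> support F (setof A) a"
        using support_image[OF F i, of "A \<inter> B" a "A \<inter> B"] AB xa by auto
      then have "A - A \<inter> B \<in> support F (setof A) a"
        using support_compl[OF FC a, of "A \<inter> B"] eA by simp
      then have "elts X - B \<in> support F X x"
        using support_image[OF F i, of "A - A \<inter> B" a "elts X - B"] AB xa by auto
      then show False using support_compl[OF FC x, of B] supp AB by blast
    qed
  qed
qed

text \<open>By maximality one inclusion is enough, and it is \<open>support_image\<close> applied to
  the preimage of \<open>B\<close>.\<close>

lemma support_pushforward:
  assumes F: "is_functor Sets Sets F" and FC: "preserves_finite_coproducts Sets Sets F"
    and x: "x \<in> elts (FObj F X)" and f: "f \<in> elts X \<rightarrow>\<^sub>E elts Y"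
  shows "pushforward (elts X) (elts Y) f (support F X x) = support F Y (FMap F X Y f x)"
proof (rule ultrafilter_maximal)
  show "ultrafilter_on (elts Y) (pushforward (elts X) (elts Y) f (support F X x))"
    using ultrafilter_pushforward[OF ultrafilter_support[OF F FC x], of f] f by (auto simp: PiE_def)
  show "ultrafilter_on (elts Y) (support F Y (FMap F X Y f x))"
    using set_functor_map[OF F, of X Y f] f x by (intro ultrafilter_support[OF F FC]) simp
  show "pushforward (elts X) (elts Y) f (support F X x) \<subseteq> support F Y (FMap F X Y f x)"
  proof
    fix B assume "B \<in> pushforward (elts X) (elts Y) f (support F X x)"
    then show "B \<in> support F Y (FMap F X Y f x)"
      unfolding pushforward_def
      by (intro support_image[OF F f, of "{x\<in>elts X. f x \<in> B}"]) auto
  qed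
qed

text \<open>Naturality at the inclusion of \<open>A\<close> carries a preimage of \<open>x\<close>
  to a preimage of \<open>t X x\<close>; maximality supplies the other inclusion.\<close>

lemma support_nat_trans:
  assumes F: "is_functor Sets Sets F" and FC: "preserves_finite_coproducts Sets Sets F"
    and G: "is_functor Sets Sets G" and GC: "preserves_finite_coproducts Sets Sets G"
    and t: "t \<in> nat_trans Sets Sets F G" and x: "x \<in> elts (FObj F X)"
  shows "support G X (t X x) = support F X x"
proof (rule sym, rule ultrafilter_maximal)
  show "ultrafilter_on (elts X) (support F X x)" by (rule ultrafilter_support[OF F FC x])
  show "ultrafilter_on (elts X) (support G X (t X x))"
    using nat_trans_Set[OF t, of X x] x by (intro ultrafilter_support[OF G GC]) simp
  show "support F X x \<subseteq> support G X (t X x)"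
  proof
    fix A assume "A \<in> support F X x"
    then obtain a where A: "A \<subseteq> elts X" and a: "a \<in> elts (FObj F (setof A))"
      and xa: "x = FMap F (setof A) X (\<lambda>a\<in>A. a) a" by (auto simp: support_def)
    have "t X x = FMap G (setof A) X (\<lambda>a\<in>A. a) (t (setof A) a)"
      using nat_trans_Set_natural[OF t, of "setof A" X "\<lambda>a\<in>A. a" a] inclusion_PiE[OF A] a
      by (simp add: xa)
    moreover have "t (setof A) a \<in> elts (FObj G (setof A))" using nat_trans_Set[OF t, of "setof A"] a by simp
    ultimately show "A \<in> support G X (t X x)" using A by (auto simp: support_def)
  qed
qed

section \<open>From endofunctors to functors on ultrafilters\<close>

definition stalk :: "('v, 'v \<Rightarrow> 'v, 'v, 'v \<Rightarrow> 'v) fctr \<Rightarrow> 'v \<times> 'v set set \<Rightarrow> 'v" where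
  "stalk F P = setof {x \<in> elts (FObj F (fst P)). support F (fst P) x = snd P}"

lemma stalk_iff [simp]:
  "x \<in> elts (stalk F (X, U)) \<longleftrightarrow> x \<in> elts (FObj F X) \<and> support F X x = U"
proof -
  have "elts (stalk F (X, U)) = {x \<in> elts (FObj F X). support F X x = U}"
    unfolding stalk_def fst_conv snd_conv by (rule elts_setof_subset[of _ "FObj F X"]) blast
  then show ?thesis by simp
qed

text \<open>A class acts through an arbitrarily chosen total representative;
  \<open>stalks_arrow\<close> shows that the choice is immaterial.\<close>

definition stalks ::
    "('v, 'v \<Rightarrow> 'v, 'v, 'v \<Rightarrow> 'v) fctr \<Rightarrow> ('v \<times> 'v set set, ('v \<rightharpoonup> 'v) set, 'v, 'v \<Rightarrow> 'v) fctr" where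
  "stalks F = \<lparr>
     FObj = (\<lambda>P\<in>Obj UF. stalk F P),
     FMap = (\<lambda>P Q c. if P \<in> Obj UF \<and> Q \<in> Obj UF \<and> c \<in> Hom UF P Q
       then (\<lambda>x\<in>elts (stalk F P). FMap F (fst P) (fst Q)
         (SOME f. f \<in> elts (fst P) \<rightarrow>\<^sub>E elts (fst Q) \<and>
            pushforward (elts (fst P)) (elts (fst Q)) f (snd P) = snd Q \<and>
            c = arrow (fst P) (snd P) (fst Q) (snd Q) f) x)
       else undefined) \<rparr>"

lemma stalks_Obj [simp]: "P \<in> Obj UF \<Longrightarrow> FObj (stalks F) P = stalk F P"
  by (simp add: stalks_def)

text \<open>The chosen representative agrees with \<open>f\<close> on a member of \<open>U\<close>,
  and \<open>U\<close> is the support of every element of the stalk, so \<open>support_eqI\<close>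
  identifies the two values.\<close>

lemma stalks_arrow:
  assumes F: "is_functor Sets Sets F" and U: "ultrafilter_on (elts X) U"
    and f: "f \<in> elts X \<rightarrow>\<^sub>E elts Y" and V: "pushforward (elts X) (elts Y) f U = V"
  shows "FMap (stalks F) (X, U) (Y, V) (arrow X U Y V f) =
    (\<lambda>x\<in>elts (stalk F (X, U)). FMap F X Y f x)"
proof -
  have f': "f \<in> elts X \<rightarrow> elts Y" using f by blast
  have V': "ultrafilter_on (elts Y) V" using ultrafilter_pushforward[OF U f'] V by simp
  define r where "r = (SOME g. g \<in> elts X \<rightarrow>\<^sub>E elts Y \<and> pushforward (elts X) (elts Y) g U = V \<and>
    arrow X U Y V f = arrow X U Y V g)"
  have r: "r \<in> elts X \<rightarrow>\<^sub>E elts Y \<and> pushforward (elts X) (elts Y) r U = V \<and>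
    arrow X U Y V f = arrow X U Y V r"
    unfolding r_def by (rule someI[of _ f]) (use f V in simp)
  then have "{x \<in> elts X. r x = f x} \<in> U"
    using total_class_eq_iff[OF U _ f', of r V] V by auto
  moreover have "FMap (stalks F) (X, U) (Y, V) (arrow X U Y V f) =
      (\<lambda>x\<in>elts (stalk F (X, U)). FMap F X Y r x)"
    using arrow_in_Hom[OF U f V] U V' by (simp add: stalks_def r_def)
  moreover have "FMap F X Y r x = FMap F X Y f x"
    if "{x \<in> elts X. r x = f x} \<in> U" "x \<in> elts (stalk F (X, U))" for x
    by (rule support_eqI[OF F]) (use r f that in auto)
  ultimately show ?thesis by (auto intro!: restrict_ext)
qed

lemma is_functor_stalks:
  assumes F: "is_functor Sets Sets F" and FC: "preserves_finite_coproducts Sets Sets F"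
  shows "is_functor UF Sets (stalks F)"
  unfolding is_functor_def
proof (intro conjI ballI allI impI)
  show "FObj (stalks F) \<in> Obj UF \<rightarrow>\<^sub>E Obj Sets"
    by (simp add: stalks_def)
  show "FMap (stalks F) P Q = (\<lambda>_. undefined)" if "P \<notin> Obj UF \<or> Q \<notin> Obj UF" for P Q
    using that by (auto simp: stalks_def)
next
  fix P Q assume P: "P \<in> Obj UF" and Q: "Q \<in> Obj UF"
  obtain X U Y V where PQ: "P = (X, U)" "Q = (Y, V)" by (cases P, cases Q)
  show "FMap (stalks F) P Q \<in> Hom UF P Q \<rightarrow>\<^sub>E Hom Sets (FObj (stalks F) P) (FObj (stalks F) Q)"
  proof (rule PiE_I)
    fix c assume "c \<in> Hom UF P Q"
    then obtain f where f: "f \<in> elts X \<rightarrow>\<^sub>E elts Y" "pushforward (elts X) (elts Y) f U = V"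
      "c = arrow X U Y V f"
      using arrow_cases P Q PQ by (metis UF_Obj)
    have "FMap F X Y f x \<in> elts (stalk F Q)" if "x \<in> elts (stalk F P)" for x
      using that set_functor_map[OF F, of X Y f x] support_pushforward[OF F FC _ f(1), of x] f
      by (auto simp: PQ)
    then show "FMap (stalks F) P Q c \<in> Hom Sets (FObj (stalks F) P) (FObj (stalks F) Q)"
      using P Q stalks_arrow[OF F _ f(1,2)] by (auto simp: f(3) PQ)
  next
    fix c assume "c \<notin> Hom UF P Q"
    then show "FMap (stalks F) P Q c = undefined" by (auto simp: stalks_def)
  qed
next
  fix P assume P: "P \<in> Obj UF"
  obtain X U where PX: "P = (X, U)" by (cases P)
  have U: "ultrafilter_on (elts X) U" using P by (simp add: PX)
  have "pushforward (elts X) (elts X) (\<lambda>x\<in>elts X. x) U = U"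
    using pushforward_id[OF ultrafilter_Pow[OF U]] pushforward_cong[of "elts X" "\<lambda>x\<in>elts X. x" "\<lambda>x. x"]
    by simp
  from stalks_arrow[OF F U _ this]
  show "FMap (stalks F) P P (Id UF P) = Id Sets (FObj (stalks F) P)"
    using P set_functor_id[OF F, of X] by (auto simp: PX UF_Id intro!: restrict_ext)
next
  fix P Q R c d
  assume P: "P \<in> Obj UF" and Q: "Q \<in> Obj UF" and R: "R \<in> Obj UF"
    and c: "c \<in> Hom UF P Q" and d: "d \<in> Hom UF Q R"
  obtain X U Y V Z W where PQR: "P = (X, U)" "Q = (Y, V)" "R = (Z, W)"
    by (cases P, cases Q, cases R)
  have U: "ultrafilter_on (elts X) U" and V: "ultrafilter_on (elts Y) V"
    and W: "ultrafilter_on (elts Z) W" using P Q R by (simp_all add: PQR)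
  obtain f where f: "f \<in> elts X \<rightarrow>\<^sub>E elts Y" "pushforward (elts X) (elts Y) f U = V"
    "c = arrow X U Y V f"
    using arrow_cases[OF U V] c unfolding PQR by metis
  obtain g where g: "g \<in> elts Y \<rightarrow>\<^sub>E elts Z" "pushforward (elts Y) (elts Z) g V = W"
    "d = arrow Y V Z W g"
    using arrow_cases[OF V W] d unfolding PQR by metis
  have gf: "compose (elts X) g f \<in> elts X \<rightarrow>\<^sub>E elts Z"
    by (rule compose_PiE[OF f(1) g(1)])
  have fx: "FMap F X Y f x \<in> elts (stalk F Q)" if "x \<in> elts (stalk F P)" for x
    using that set_functor_map[OF F, of X Y f x] support_pushforward[OF F FC _ f(1), of x] f
    by (auto simp: PQR)
  have "FMap (stalks F) P R (Comp UF P Q R d c) =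
      (\<lambda>x\<in>elts (stalk F P). FMap F X Z (compose (elts X) g f) x)"
    unfolding PQR f(3) g(3) arrow_comp[OF U f(1) g(1) f(2) g(2)]
    by (rule stalks_arrow[OF F U gf pushforward_compose[OF f(1,2) g(2)]])
  also have "\<dots> = (\<lambda>x\<in>elts (stalk F P). FMap F Y Z g (FMap F X Y f x))"
    by (rule restrict_ext) (use set_functor_comp[OF F, of X Y Z f g] f g in \<open>simp add: PQR\<close>)
  also have "\<dots> = compose (elts (stalk F P)) (FMap (stalks F) Q R d) (FMap (stalks F) P Q c)"
    unfolding compose_def f(3) g(3) PQR stalks_arrow[OF F U f(1,2)] stalks_arrow[OF F V g(1,2)]
    using fx by (intro restrict_ext) (simp add: PQR)
  finally show "FMap (stalks F) P R (Comp UF P Q R d c) =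
      Comp Sets (FObj (stalks F) P) (FObj (stalks F) Q) (FObj (stalks F) R)
        (FMap (stalks F) Q R d) (FMap (stalks F) P Q c)"
    using P by simp
qed

section \<open>Natural transformations and their restrictions to stalks\<close>

abbreviation FC :: "(('v, 'v \<Rightarrow> 'v, 'v, 'v \<Rightarrow> 'v) fctr, 'v \<Rightarrow> 'v \<Rightarrow> 'v) cat"
  where "FC \<equiv> FC_category Sets Sets"

abbreviation UFSet ::
    "(('v \<times> 'v set set, ('v \<rightharpoonup> 'v) set, 'v, 'v \<Rightarrow> 'v) fctr, 'v \<times> 'v set set \<Rightarrow> 'v \<Rightarrow> 'v) cat"
  where "UFSet \<equiv> functor_category UF Sets"

lemma FC_simps [simp]:
  "F \<in> Obj FC \<longleftrightarrow> is_functor Sets Sets F \<and> preserves_finite_coproducts Sets Sets F"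
  "Hom FC = nat_trans Sets Sets"
  "Id FC F = (\<lambda>X. \<lambda>x\<in>elts (FObj F X). x)"
  "Comp FC F G H t s = (\<lambda>X. compose (elts (FObj F X)) (t X) (s X))"
  by (auto simp: FC_category_def)

definition stalks_nat ::
    "('v, 'v \<Rightarrow> 'v, 'v, 'v \<Rightarrow> 'v) fctr \<Rightarrow> ('v \<Rightarrow> 'v \<Rightarrow> 'v) \<Rightarrow> 'v \<times> 'v set set \<Rightarrow> 'v \<Rightarrow> 'v" where
  "stalks_nat F t = (\<lambda>P\<in>Obj UF. \<lambda>x\<in>elts (stalk F P). t (fst P) x)"

text \<open>Since \<open>t\<close> preserves supports, its restriction lands in the stalk at the
  same ultrafilter.\<close>

lemma stalks_nat_trans:
  assumes F: "F \<in> Obj FC" and G: "G \<in> Obj FC" and t: "t \<in> nat_trans Sets Sets F G"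
  shows "stalks_nat F t \<in> nat_trans UF Sets (stalks F) (stalks G)"
proof (rule nat_trans_SetI)
  have F': "is_functor Sets Sets F" and FC: "preserves_finite_coproducts Sets Sets F"
    and G': "is_functor Sets Sets G" and GC: "preserves_finite_coproducts Sets Sets G"
    using F G by simp_all
  show "is_functor UF Sets (stalks F)" "is_functor UF Sets (stalks G)"
    using is_functor_stalks F' FC G' GC by blast+
  have tx: "t X x \<in> elts (stalk G (X, U))" if "x \<in> elts (stalk F (X, U))" for X U x
    using that nat_trans_Set[OF t, of X x] support_nat_trans[OF F' FC G' GC t, of x X] by simp
  show "stalks_nat F t P \<in> elts (FObj (stalks F) P) \<rightarrow>\<^sub>E elts (FObj (stalks G) P)" if "P \<in> Obj UF" for P
    using that tx by (cases P) (auto simp: stalks_nat_def)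
  show "stalks_nat F t P = undefined" if "P \<notin> Obj UF" for P
    using that by (simp add: stalks_nat_def)
  fix P Q c x
  assume P: "P \<in> Obj UF" and Q: "Q \<in> Obj UF" and c: "c \<in> Hom UF P Q"
    and x: "x \<in> elts (FObj (stalks F) P)"
  obtain X U Y V where PQ: "P = (X, U)" "Q = (Y, V)" by (cases P, cases Q)
  have U: "ultrafilter_on (elts X) U" and V: "ultrafilter_on (elts Y) V"
    using P Q by (simp_all add: PQ)
  have x': "x \<in> elts (stalk F (X, U))" using x P by (simp add: PQ)
  obtain f where f: "f \<in> elts X \<rightarrow>\<^sub>E elts Y" "pushforward (elts X) (elts Y) f U = V"
    "c = arrow X U Y V f"
    using arrow_cases[OF U V] c unfolding PQ by metis
  have "FMap (stalks F) P Q c x \<in> elts (stalk F Q)"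
    using set_functor_map[OF is_functor_stalks[OF F' FC] P Q c x] Q by simp
  then show "stalks_nat F t Q (FMap (stalks F) P Q c x) = FMap (stalks G) P Q c (stalks_nat F t P x)"
    using P Q x' tx[OF x'] nat_trans_Set_natural[OF t, of X Y f x] f(1)
    unfolding PQ f(3) stalks_arrow[OF F' U f(1,2)] stalks_arrow[OF G' U f(1,2)]
    by (simp add: stalks_nat_def)
qed

text \<open>The stalks at the ultrafilters on \<open>X\<close> partition the elements of
  \<open>F X\<close>, so a transformation is determined by its restrictions and can be glued from
  them.\<close>

lemma bij_betw_stalks_nat:
  assumes F: "F \<in> Obj FC" and G: "G \<in> Obj FC"
  shows "bij_betw (stalks_nat F) (nat_trans Sets Sets F G) (nat_trans UF Sets (stalks F) (stalks G))"
proof -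
  have F': "is_functor Sets Sets F" and FC: "preserves_finite_coproducts Sets Sets F"
    and G': "is_functor Sets Sets G" and GC: "preserves_finite_coproducts Sets Sets G"
    using F G by simp_all
  have "inj_on (stalks_nat F) (nat_trans Sets Sets F G)"
  proof (rule inj_onI)
    fix s t assume s: "s \<in> nat_trans Sets Sets F G" and t: "t \<in> nat_trans Sets Sets F G"
      and eq: "stalks_nat F s = stalks_nat F t"
    have "s X x = t X x" if "x \<in> elts (FObj F X)" for X x
    proof -
      have "stalks_nat F s (X, support F X x) x = stalks_nat F t (X, support F X x) x"
        by (simp only: eq)
      then show ?thesis using that ultrafilter_support[OF F' FC that] by (simp add: stalks_nat_def)
    qed
    then have "s X = t X" for X
      using nat_trans_component[OF s, of X] nat_trans_component[OF t, of X]
      by (intro PiE_ext[of "s X" "elts (FObj F X)" "\<lambda>_. elts (FObj G X)" "t X"]) auto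
    then show "s = t" by (rule ext)
  qed
  moreover have "\<exists>t\<in>nat_trans Sets Sets F G. stalks_nat F t = r"
    if r: "r \<in> nat_trans UF Sets (stalks F) (stalks G)" for r
  proof
    \<comment> \<open>Each element lies in one stalk only, the one at its own support, so there are
      no overlaps to reconcile.\<close>
    define t where "t X = (\<lambda>x\<in>elts (FObj F X). r (X, support F X x) x)" for X
    have rx: "r (X, support F X x) x \<in> elts (stalk G (X, support F X x))"
      if "x \<in> elts (FObj F X)" for X x
      using nat_trans_Set[OF r, of "(X, support F X x)" x] that ultrafilter_support[OF F' FC that]
      by (simp del: stalk_iff add: stalk_iff[of x F])
    show "t \<in> nat_trans Sets Sets F G"
    proof (rule nat_trans_SetI[OF F' G'])
      fix X Y f x assume "f \<in> Hom Sets X Y" and x: "x \<in> elts (FObj F X)"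
      then have f: "f \<in> elts X \<rightarrow>\<^sub>E elts Y" by simp
      let ?U = "support F X x" and ?V = "support F Y (FMap F X Y f x)"
      have U: "ultrafilter_on (elts X) ?U" by (rule ultrafilter_support[OF F' FC x])
      have fx: "FMap F X Y f x \<in> elts (FObj F Y)" using set_functor_map[OF F', of X Y f x] f x by simp
      have V: "ultrafilter_on (elts Y) ?V" by (rule ultrafilter_support[OF F' FC fx])
      have push: "pushforward (elts X) (elts Y) f ?U = ?V" by (rule support_pushforward[OF F' FC x f])
      \<comment> \<open>Any \<open>f\<close> is an arrow from the support of \<open>x\<close> to the
        support of its image, so naturality of \<open>r\<close> at that arrow yields naturality of
        \<open>t\<close> at \<open>f\<close>.\<close>
      have "r (Y, ?V) (FMap (stalks F) (X, ?U) (Y, ?V) (arrow X ?U Y ?V f) x) =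
          FMap (stalks G) (X, ?U) (Y, ?V) (arrow X ?U Y ?V f) (r (X, ?U) x)"
        by (rule nat_trans_Set_natural[OF r]) (use U V x arrow_in_Hom[OF U f push] in simp_all)
      then show "t Y (FMap F X Y f x) = FMap G X Y f (t X x)"
        unfolding stalks_arrow[OF F' U f push] stalks_arrow[OF G' U f push] t_def
        using x fx rx[OF x] by simp
    qed (use rx in \<open>auto simp: t_def\<close>)
    have "stalks_nat F t P = r P" if P: "P \<in> Obj UF" for P
    proof -
      have "r P \<in> extensional (elts (stalk F P))"
        using nat_trans_component[OF r P] P by (simp add: PiE_def)
      then show ?thesis
        using P by (cases P) (auto simp: stalks_nat_def t_def extensional_def fun_eq_iff)
    qed
    moreover have "stalks_nat F t P = r P" if "P \<notin> Obj UF" for P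
      using nat_trans_undefined[OF r that] that by (simp add: stalks_nat_def)
    ultimately show "stalks_nat F t = r" by (intro ext) metis
  qed
  ultimately show ?thesis
    unfolding bij_betw_def using stalks_nat_trans[OF F G] by (auto simp: image_iff)
qed

section \<open>The functor of stalks\<close>

definition stalks_functor ::
    "(('v, 'v \<Rightarrow> 'v, 'v, 'v \<Rightarrow> 'v) fctr, 'v \<Rightarrow> 'v \<Rightarrow> 'v,
      ('v \<times> 'v set set, ('v \<rightharpoonup> 'v) set, 'v, 'v \<Rightarrow> 'v) fctr,
      'v \<times> 'v set set \<Rightarrow> 'v \<Rightarrow> 'v) fctr" where
  "stalks_functor = \<lparr>
     FObj = (\<lambda>F\<in>Obj FC. stalks F),
     FMap = (\<lambda>F G t. if F \<in> Obj FC \<and> G \<in> Obj FC \<and> t \<in> nat_trans Sets Sets F G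
       then stalks_nat F t else undefined) \<rparr>"

lemma stalks_functor_simps [simp]:
  "F \<in> Obj FC \<Longrightarrow> FObj stalks_functor F = stalks F"
  "F \<in> Obj FC \<Longrightarrow> G \<in> Obj FC \<Longrightarrow> t \<in> nat_trans Sets Sets F G \<Longrightarrow>
    FMap stalks_functor F G t = stalks_nat F t"
  by (simp_all add: stalks_functor_def)

lemma is_functor_stalks_functor: "is_functor FC UFSet stalks_functor"
  unfolding is_functor_def
proof (intro conjI ballI allI impI)
  show "FObj stalks_functor \<in> Obj FC \<rightarrow>\<^sub>E Obj UFSet"
    by (auto simp: stalks_functor_def is_functor_stalks)
  show "FMap stalks_functor F G \<in> Hom FC F G \<rightarrow>\<^sub>E Hom UFSet (FObj stalks_functor F) (FObj stalks_functor G)"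
    if "F \<in> Obj FC" "G \<in> Obj FC" for F G
  proof (rule PiE_I)
    show "FMap stalks_functor F G t \<in> Hom UFSet (FObj stalks_functor F) (FObj stalks_functor G)"
      if "t \<in> Hom FC F G" for t
      using stalks_nat_trans[OF \<open>F \<in> Obj FC\<close> \<open>G \<in> Obj FC\<close>, of t] that \<open>F \<in> Obj FC\<close> \<open>G \<in> Obj FC\<close>
      by (simp del: FC_simps(1) add: FC_simps(2))
    show "FMap stalks_functor F G t = undefined" if "t \<notin> Hom FC F G" for t
      using that by (auto simp: stalks_functor_def)
  qed
  show "FMap stalks_functor F G = (\<lambda>_. undefined)" if "F \<notin> Obj FC \<or> G \<notin> Obj FC" for F G
    using that by (auto simp: stalks_functor_def)
  show "FMap stalks_functor F F (Id FC F) = Id UFSet (FObj stalks_functor F)" if F: "F \<in> Obj FC" for F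
  proof -
    have "Id FC F \<in> nat_trans Sets Sets F F"
      using nat_trans_id[OF category_Set[of elts], where C = Sets and F = F] F by (simp add: restrict_UNIV)
    then show ?thesis
      using F by (auto simp: stalks_nat_def intro!: restrict_ext)
  qed
  show "FMap stalks_functor F H (Comp FC F G H t s) =
      Comp UFSet (FObj stalks_functor F) (FObj stalks_functor G) (FObj stalks_functor H)
        (FMap stalks_functor G H t) (FMap stalks_functor F G s)"
    if F: "F \<in> Obj FC" and G: "G \<in> Obj FC" and H: "H \<in> Obj FC"
      and s: "s \<in> Hom FC F G" and t: "t \<in> Hom FC G H" for F G H s t
  proof -
    have st: "Comp FC F G H t s \<in> nat_trans Sets Sets F H"
      using nat_trans_comp[OF category_Set[of elts], where C = Sets and F = F and G = G and H = H and s = s and t = t] F G H s t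
      by (simp add: restrict_UNIV)
    have s': "s X x \<in> elts (stalk G (X, U))" if "x \<in> elts (stalk F (X, U))" for X U x
      using that nat_trans_Set[of s Sets F G X x] support_nat_trans[of F G s x X] F G s by simp
    have "stalks_nat F (Comp FC F G H t s) P =
        compose (elts (stalk F P)) (stalks_nat G t P) (stalks_nat F s P)" if "P \<in> Obj UF" for P
      using that s'
      by (cases P) (auto simp: stalks_nat_def compose_def intro!: restrict_ext)
    moreover have "stalks_nat F u P = undefined" if "P \<notin> Obj UF" for u P
      using that by (simp add: stalks_nat_def)
    ultimately have "stalks_nat F (Comp FC F G H t s) P = (\<lambda>P\<in>Obj UF. Comp Sets (FObj (stalks F) P)
        (FObj (stalks G) P) (FObj (stalks H) P) (stalks_nat G t P) (stalks_nat F s P)) P" for P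
      by (cases "P \<in> Obj UF") simp_all
    then have "stalks_nat F (Comp FC F G H t s) = (\<lambda>P\<in>Obj UF. Comp Sets (FObj (stalks F) P)
        (FObj (stalks G) P) (FObj (stalks H) P) (stalks_nat G t P) (stalks_nat F s P))"
      by (rule ext)
    then show ?thesis
      using F G H s t st by (simp del: FC_simps(1,4) add: FC_simps(2))
  qed
qed

section \<open>From functors on ultrafilters to endofunctors\<close>

abbreviation push :: "'v \<Rightarrow> 'v \<Rightarrow> ('v \<Rightarrow> 'v) \<Rightarrow> 'v set set \<Rightarrow> 'v set set" where
  "push X Y \<equiv> pushforward (elts X) (elts Y)"

lemma ultrafilter_push:
  "ultrafilter_on (elts X) U \<Longrightarrow> f \<in> elts X \<rightarrow>\<^sub>E elts Y \<Longrightarrow> ultrafilter_on (elts Y) (push X Y f U)"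
  by (rule ultrafilter_pushforward) auto

lemma push_id: "ultrafilter_on (elts X) U \<Longrightarrow> push X X (\<lambda>x\<in>elts X. x) U = U"
  using pushforward_id[OF ultrafilter_Pow] pushforward_cong[of "elts X" "\<lambda>x\<in>elts X. x" "\<lambda>x. x"]
  by simp

lemma push_compose:
  "f \<in> elts X \<rightarrow>\<^sub>E elts Y \<Longrightarrow> push Y Z g (push X Y f U) = push X Z (compose (elts X) g f) U"
  by (rule pushforward_compose[symmetric]) auto

text \<open>With the target ultrafilter taken to be the pushforward, every total function between
  the sets is an arrow, so \<open>G\<close> acts on functions without a continuity
  condition.\<close>

definition act ::
    "('v \<times> 'v set set, ('v \<rightharpoonup> 'v) set, 'v, 'v \<Rightarrow> 'v) fctr \<Rightarrow> 'v \<Rightarrow> 'v set set \<Rightarrow> 'v \<Rightarrow>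
     ('v \<Rightarrow> 'v) \<Rightarrow> 'v \<Rightarrow> 'v" where
  "act G X U Y f = FMap G (X, U) (Y, push X Y f U) (arrow X U Y (push X Y f U) f)"

context
  fixes G :: "('v \<times> 'v set set, ('v \<rightharpoonup> 'v) set, 'v, 'v \<Rightarrow> 'v) fctr"
  assumes G: "is_functor UF Sets G"
begin

lemma act_mem:
  assumes "ultrafilter_on (elts X) U" "f \<in> elts X \<rightarrow>\<^sub>E elts Y" "g \<in> elts (FObj G (X, U))"
  shows "act G X U Y f g \<in> elts (FObj G (Y, push X Y f U))"
  unfolding act_def
  by (rule set_functor_map[OF G])
    (use assms ultrafilter_push arrow_in_Hom in auto)

lemma act_id:
  assumes "ultrafilter_on (elts X) U" "g \<in> elts (FObj G (X, U))"
  shows "act G X U X (\<lambda>x\<in>elts X. x) g = g"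
  using set_functor_id[OF G, of "(X, U)" g] assms by (simp add: act_def push_id UF_Id)

lemma act_comp:
  assumes U: "ultrafilter_on (elts X) U" and f: "f \<in> elts X \<rightarrow>\<^sub>E elts Y" and k: "k \<in> elts Y \<rightarrow>\<^sub>E elts Z"
    and g: "g \<in> elts (FObj G (X, U))"
  shows "act G Y (push X Y f U) Z k (act G X U Y f g) = act G X U Z (compose (elts X) k f) g"
proof -
  let ?V = "push X Y f U" and ?W = "push Y Z k (push X Y f U)"
  have V: "ultrafilter_on (elts Y) ?V" by (rule ultrafilter_push[OF U f])
  have W: "ultrafilter_on (elts Z) ?W" by (rule ultrafilter_push[OF V k])
  have "act G Y ?V Z k (act G X U Y f g) =
      FMap G (X, U) (Z, ?W) (Comp UF (X, U) (Y, ?V) (Z, ?W) (arrow Y ?V Z ?W k) (arrow X U Y ?V f)) g"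
    unfolding act_def
    by (rule set_functor_comp[OF G]) (use U V W f k g arrow_in_Hom in auto)
  then show ?thesis
    unfolding arrow_comp[OF U f k refl refl] by (simp add: act_def push_compose[OF f])
qed

text \<open>The pushforwards must be identified first: only then do the two classes belong to the
  same hom-set and become comparable.\<close>

lemma act_cong:
  assumes U: "ultrafilter_on (elts X) U" and f: "f \<in> elts X \<rightarrow>\<^sub>E elts Y" and f': "f' \<in> elts X \<rightarrow>\<^sub>E elts Y"
    and eq: "{x\<in>elts X. f x = f' x} \<in> U"
  shows "push X Y f U = push X Y f' U" "act G X U Y f = act G X U Y f'"
proof -
  show p: "push X Y f U = push X Y f' U" by (rule pushforward_eq_mod[OF U eq])
  have "arrow X U Y (push X Y f' U) f = arrow X U Y (push X Y f' U) f'"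
    by (subst total_class_eq_iff[OF U _ _ p refl]) (use f f' eq in auto)
  then show "act G X U Y f = act G X U Y f'" by (simp add: act_def p)
qed

text \<open>The domain carries an ultrafilter and is nonempty, so \<open>f\<close> has a retraction,
  whose action undoes that of \<open>f\<close>.\<close>

lemma act_inj:
  assumes U: "ultrafilter_on (elts X) U" and f: "f \<in> elts X \<rightarrow>\<^sub>E elts Y" and inj: "inj_on f (elts X)"
    and g: "g \<in> elts (FObj G (X, U))" and g': "g' \<in> elts (FObj G (X, U))"
    and eq: "act G X U Y f g = act G X U Y f g'"
  shows "g = g'"
proof -
  have "elts X \<noteq> {}" using ultrafilter_top[OF U] ultrafilter_empty[OF U] by auto
  from retraction_exists[OF inj this] obtain r where r: "r \<in> elts Y \<rightarrow>\<^sub>E elts X"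
    and rf: "\<And>x. x \<in> elts X \<Longrightarrow> f x \<in> elts Y \<Longrightarrow> r (f x) = x" by blast
  have rf: "compose (elts X) r f = (\<lambda>x\<in>elts X. x)"
    unfolding compose_def by (rule restrict_ext) (use rf f in auto)
  have "act G Y (push X Y f U) X r (act G X U Y f h) = h" if "h \<in> elts (FObj G (X, U))" for h
    unfolding act_comp[OF U f r that] rf by (rule act_id[OF U that])
  from this[OF g, unfolded eq] this[OF g'] show ?thesis by (rule trans[OF sym])
qed

text \<open>
  The inverse construction: the coproduct of the values of \<open>G\<close> at the ultrafilters on \<open>X\<close>.
\<close>

definition usum :: "'v \<Rightarrow> 'v" where
  "usum X = setof {opair (ucode U) g | U g. ultrafilter_on (elts X) U \<and> g \<in> elts (FObj G (X, U))}"

text \<open>The issue is smallness: the sum is cut out of a union over the double power set of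
  \<open>X\<close>, which contains all codes.\<close>

lemma elts_usum:
  "elts (usum X) = {opair (ucode U) g | U g. ultrafilter_on (elts X) U \<and> g \<in> elts (FObj G (X, U))}"
  (is "_ = ?S")
  unfolding usum_def
proof (rule elts_setof, rule small_subset)
  let ?K = "{w. elts w \<subseteq> {z. elts z \<subseteq> elts X}}"
  \<comment> \<open>The image of \<open>elts c\<close> under \<open>elts\<close> decodes
    \<open>c\<close>. Where \<open>c\<close> codes no ultrafilter the fibre is some irrelevant small
    set, which an upper bound may contain.\<close>
  let ?T = "\<lambda>c. opair c ` elts (FObj G (X, elts ` elts c))"
  show "small (\<Union>c\<in>?K. ?T c)"
    by (intro small_UN small_small_subsets small_elts small_image)
  show "?S \<subseteq> (\<Union>c\<in>?K. ?T c)"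
  proof clarify
    fix U g assume U: "ultrafilter_on (elts X) U" and g: "g \<in> elts (FObj G (X, U))"
    note P = ultrafilter_Pow[OF U]
    have "elts ` elts (ucode U) = U"
      unfolding ucode_def elts_setof[OF ucode_bounded(1)[OF P]] by (rule elts_image_setof[OF P])
    then have "opair (ucode U) g \<in> ?T (ucode U)" using g by simp
    then show "opair (ucode U) g \<in> (\<Union>c\<in>?K. ?T c)"
      by (rule UN_I[OF ucode_bounded(2)[OF P]])
  qed
qed

lemma usumI:
  "ultrafilter_on (elts X) U \<Longrightarrow> g \<in> elts (FObj G (X, U)) \<Longrightarrow> opair (ucode U) g \<in> elts (usum X)"
  unfolding elts_usum by blast

lemma usumE:
  assumes "p \<in> elts (usum X)"
  obtains U g where "ultrafilter_on (elts X) U" "g \<in> elts (FObj G (X, U))" "p = opair (ucode U) g"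
  using assms unfolding elts_usum by blast

lemma ucode_ultrafilter_eq_iff:
  "ultrafilter_on (elts X) U \<Longrightarrow> ultrafilter_on (elts Y) V \<Longrightarrow> ucode U = ucode V \<longleftrightarrow> U = V"
  by (rule ucode_inject[OF ultrafilter_Pow ultrafilter_Pow])

text \<open>The description unpacks the tagged pair \<open>p\<close>; it is well defined because
  pairing, and coding on ultrafilters, are injective.\<close>

definition usum_map :: "'v \<Rightarrow> 'v \<Rightarrow> ('v \<Rightarrow> 'v) \<Rightarrow> 'v \<Rightarrow> 'v" where
  "usum_map X Y f = (\<lambda>p\<in>elts (usum X). THE q. \<exists>U g. ultrafilter_on (elts X) U \<and>
     g \<in> elts (FObj G (X, U)) \<and> p = opair (ucode U) g \<and>
     q = opair (ucode (push X Y f U)) (act G X U Y f g))"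

lemma usum_map_opair:
  assumes U: "ultrafilter_on (elts X) U" and g: "g \<in> elts (FObj G (X, U))"
  shows "usum_map X Y f (opair (ucode U) g) = opair (ucode (push X Y f U)) (act G X U Y f g)"
proof -
  have "(THE q. \<exists>U' g'. ultrafilter_on (elts X) U' \<and>
      g' \<in> elts (FObj G (X, U')) \<and> opair (ucode U) g = opair (ucode U') g' \<and>
      q = opair (ucode (push X Y f U')) (act G X U' Y f g')) =
    opair (ucode (push X Y f U)) (act G X U Y f g)"
  proof (rule the_equality)
    show "\<exists>U' g'. ultrafilter_on (elts X) U' \<and> g' \<in> elts (FObj G (X, U')) \<and>
        opair (ucode U) g = opair (ucode U') g' \<and>
        opair (ucode (push X Y f U)) (act G X U Y f g) =
        opair (ucode (push X Y f U')) (act G X U' Y f g')"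
      using U g by blast
  qed (use U in \<open>auto simp: ucode_ultrafilter_eq_iff\<close>)
  then show ?thesis using usumI[OF U g] by (simp add: usum_map_def)
qed

lemma usum_map_PiE:
  assumes f: "f \<in> elts X \<rightarrow>\<^sub>E elts Y"
  shows "usum_map X Y f \<in> elts (usum X) \<rightarrow>\<^sub>E elts (usum Y)"
proof (rule PiE_I)
  fix p assume "p \<in> elts (usum X)"
  then show "usum_map X Y f p \<in> elts (usum Y)"
    by (rule usumE) (simp add: usum_map_opair usumI ultrafilter_push[OF _ f] act_mem[OF _ f])
qed (simp add: usum_map_def)

definition usums :: "('v, 'v \<Rightarrow> 'v, 'v, 'v \<Rightarrow> 'v) fctr" where
  "usums = \<lparr>FObj = usum,
     FMap = (\<lambda>X Y f. if f \<in> elts X \<rightarrow>\<^sub>E elts Y then usum_map X Y f else undefined)\<rparr>"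

lemma usums_simps [simp]:
  "FObj usums = usum"
  "f \<in> elts X \<rightarrow>\<^sub>E elts Y \<Longrightarrow> FMap usums X Y f = usum_map X Y f"
  by (simp_all add: usums_def)

lemma is_functor_usums: "is_functor Sets Sets usums"
  unfolding is_functor_def
proof (intro conjI ballI allI impI)
  show "FObj usums \<in> Obj Sets \<rightarrow>\<^sub>E Obj Sets" by simp
  show "FMap usums X Y \<in> Hom Sets X Y \<rightarrow>\<^sub>E Hom Sets (FObj usums X) (FObj usums Y)" for X Y
  proof (rule PiE_I)
    show "FMap usums X Y f \<in> Hom Sets (FObj usums X) (FObj usums Y)" if "f \<in> Hom Sets X Y" for f
      using that usum_map_PiE[of f X Y] by simp
    show "FMap usums X Y f = undefined" if "f \<notin> Hom Sets X Y" for f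
      using that by (simp add: usums_def)
  qed
  show "FMap usums X Y = (\<lambda>_. undefined)" if "X \<notin> Obj Sets \<or> Y \<notin> Obj Sets" for X Y
    using that by simp
  show "FMap usums X X (Id Sets X) = Id Sets (FObj usums X)" for X
  proof -
    have i: "(\<lambda>x\<in>elts X. x) \<in> elts X \<rightarrow>\<^sub>E elts X" by auto
    have "usum_map X X (\<lambda>x\<in>elts X. x) p = p" if "p \<in> elts (usum X)" for p
      using that by (rule usumE) (simp add: usum_map_opair push_id act_id)
    then have "usum_map X X (\<lambda>x\<in>elts X. x) = (\<lambda>p\<in>elts (usum X). p)"
      by (intro PiE_ext[OF usum_map_PiE[OF i]]) auto
    then show ?thesis using i by simp
  qed
  fix X Y Z f k assume "f \<in> Hom Sets X Y" "k \<in> Hom Sets Y Z"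
  then have f: "f \<in> elts X \<rightarrow>\<^sub>E elts Y" and k: "k \<in> elts Y \<rightarrow>\<^sub>E elts Z" by simp_all
  note kf = compose_PiE[OF f k]
  have "usum_map X Z (compose (elts X) k f) p = compose (elts (usum X)) (usum_map Y Z k) (usum_map X Y f) p"
    if "p \<in> elts (usum X)" for p
    using that
    by (rule usumE) (simp add: usumI compose_eq usum_map_opair ultrafilter_push[OF _ f]
        act_mem[OF _ f] push_compose[OF f] act_comp[OF _ f k])
  then have "usum_map X Z (compose (elts X) k f) = compose (elts (usum X)) (usum_map Y Z k) (usum_map X Y f)"
    by (intro PiE_ext[OF usum_map_PiE[OF kf] compose_PiE[OF usum_map_PiE[OF f] usum_map_PiE[OF k]]])
  then show "FMap usums X Z (Comp Sets X Y Z k f) =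
      Comp Sets (FObj usums X) (FObj usums Y) (FObj usums Z) (FMap usums Y Z k) (FMap usums X Y f)"
    using f k kf by simp
qed

text \<open>By \<open>coproduct_Set_iff\<close> the claim is a bijection between tagged pairs.
  Finiteness of \<open>I\<close> enters through \<open>ultrafilter_finite_UN\<close>, which finds
  the block carrying a given ultrafilter on \<open>P\<close>.\<close>

lemma usums_preserves: "preserves_finite_coproducts Sets Sets usums"
  unfolding preserves_finite_coproducts_def
proof (intro allI impI, elim conjE)
  fix I :: "nat set" and A P j assume fin: "finite I" and cop: "is_coproduct Sets I A P j"
  have j: "j i \<in> elts (A i) \<rightarrow>\<^sub>E elts P" if "i \<in> I" for i
    using cop that unfolding coproduct_Set_iff by blast
  have bij: "bij_betw (\<lambda>(i, a). j i a) (SIGMA i:I. elts (A i)) (elts P)"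
    using cop unfolding coproduct_Set_iff by blast
  have jj: "i = k \<and> a = b" if "i \<in> I" "k \<in> I" "a \<in> elts (A i)" "b \<in> elts (A k)" "j i a = j k b" for i k a b
    using bij_betw_imp_inj_on[OF bij, THEN inj_onD, of "(i, a)" "(k, b)"] that by simp
  have inj: "inj_on (j i) (elts (A i))" if "i \<in> I" for i
    using jj[OF that that] by (auto intro: inj_onI)
  have range: "j i ` elts (A i) \<in> push (A i) P (j i) U" if "i \<in> I" "ultrafilter_on (elts (A i)) U" for i U
  proof -
    have "{a \<in> elts (A i). j i a \<in> j i ` elts (A i)} = elts (A i)" by blast
    then show ?thesis using j[OF that(1)] ultrafilter_top[OF that(2)] by (auto simp: pushforward_def)
  qed
  have "bij_betw (\<lambda>(i, p). usum_map (A i) P (j i) p) (SIGMA i:I. elts (usum (A i))) (elts (usum P))"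
  proof (rule bij_betw_imageI)
    show "inj_on (\<lambda>(i, p). usum_map (A i) P (j i) p) (SIGMA i:I. elts (usum (A i)))"
    proof (rule inj_onI, clarify)
      fix i p k q assume i: "i \<in> I" and p: "p \<in> elts (usum (A i))" and k: "k \<in> I"
        and q: "q \<in> elts (usum (A k))" and eq: "usum_map (A i) P (j i) p = usum_map (A k) P (j k) q"
      obtain U g where U: "ultrafilter_on (elts (A i)) U" and g: "g \<in> elts (FObj G (A i, U))"
        and p: "p = opair (ucode U) g" using p by (rule usumE)
      obtain U' g' where U': "ultrafilter_on (elts (A k)) U'" and g': "g' \<in> elts (FObj G (A k, U'))"
        and q: "q = opair (ucode U') g'" using q by (rule usumE)
      have V: "ultrafilter_on (elts P) (push (A i) P (j i) U)" by (rule ultrafilter_push[OF U j[OF i]])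
      have V': "ultrafilter_on (elts P) (push (A k) P (j k) U')" by (rule ultrafilter_push[OF U' j[OF k]])
      have pp: "push (A i) P (j i) U = push (A k) P (j k) U'"
        and aa: "act G (A i) U P (j i) g = act G (A k) U' P (j k) g'"
        using eq by (simp_all add: p q usum_map_opair U U' g g' ucode_ultrafilter_eq_iff[OF V V'])
      \<comment> \<open>Both images belong to one ultrafilter and therefore meet, whereas distinct
        blocks have disjoint images.\<close>
      have "j i ` elts (A i) \<inter> j k ` elts (A k) \<noteq> {}"
        using ultrafilter_disjoint[OF V] range[OF i U] range[OF k U'] pp by simp
      then have ik: "i = k" using jj[OF i k] by blast
      then have "U = U'"
        using pushforward_inj[OF inj[OF i], of "elts P" U U'] j[OF i] pp
          ultrafilter_Pow[OF U] ultrafilter_Pow[OF U'] by auto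
      then show "i = k \<and> p = q"
        using ik act_inj[OF U j[OF i] inj[OF i] g] g' aa by (auto simp: p q)
    qed
    show "(\<lambda>(i, p). usum_map (A i) P (j i) p) ` (SIGMA i:I. elts (usum (A i))) = elts (usum P)"
    proof
      show "(\<lambda>(i, p). usum_map (A i) P (j i) p) ` (SIGMA i:I. elts (usum (A i))) \<subseteq> elts (usum P)"
        using usum_map_PiE[OF j] by (auto dest: PiE_mem)
      show "elts (usum P) \<subseteq> (\<lambda>(i, p). usum_map (A i) P (j i) p) ` (SIGMA i:I. elts (usum (A i)))"
      proof
        fix q assume "q \<in> elts (usum P)"
        then obtain W h where W: "ultrafilter_on (elts P) W" and h: "h \<in> elts (FObj G (P, W))"
          and q: "q = opair (ucode W) h" by (rule usumE)
        have "(\<Union>i\<in>I. j i ` elts (A i)) = elts P"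
          using bij_betw_imp_surj_on[OF bij] by force
        then have "(\<Union>i\<in>I. j i ` elts (A i)) \<in> W" using ultrafilter_top[OF W] by simp
        then have "\<exists>i\<in>I. j i ` elts (A i) \<in> W"
          by (intro ultrafilter_finite_UN[OF W fin]) (use j in auto)
        then obtain i where i: "i \<in> I" and iW: "j i ` elts (A i) \<in> W" by blast
        have "elts (A i) \<noteq> {}" using iW ultrafilter_empty[OF W] by auto
        \<comment> \<open>\<open>j i\<close> after \<open>r\<close> is the identity only on the
          image of \<open>A i\<close>. That image is a member of \<open>W\<close>, so
          \<open>act_cong\<close> lets the composite act as the identity, and transporting
          \<open>h\<close> along \<open>r\<close> gives its preimage.\<close>
        from retraction_exists[OF inj[OF i] this] obtain r where r: "r \<in> elts P \<rightarrow>\<^sub>E elts (A i)"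
          and rj: "\<And>a. a \<in> elts (A i) \<Longrightarrow> j i a \<in> elts P \<Longrightarrow> r (j i a) = a" by blast
        have id: "(\<lambda>x\<in>elts P. x) \<in> elts P \<rightarrow>\<^sub>E elts P" by auto
        have eq: "{x\<in>elts P. compose (elts P) (j i) r x = (\<lambda>x\<in>elts P. x) x} \<in> W"
          by (rule ultrafilter_mono[OF W iW]) (use j[OF i] rj in \<open>auto simp: compose_eq\<close>)
        note jr = compose_PiE[OF r j[OF i]]
        define U g where "U = push P (A i) r W" and "g = act G P W (A i) r h"
        have U: "ultrafilter_on (elts (A i)) U" unfolding U_def by (rule ultrafilter_push[OF W r])
        have g: "g \<in> elts (FObj G (A i, U))" unfolding U_def g_def by (rule act_mem[OF W r h])
        have "push (A i) P (j i) U = W"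
          unfolding U_def push_compose[OF r] act_cong(1)[OF W jr id eq] by (rule push_id[OF W])
        moreover have "act G (A i) U P (j i) g = h"
          unfolding U_def g_def act_comp[OF W r j[OF i] h] act_cong(2)[OF W jr id eq]
          by (rule act_id[OF W h])
        ultimately have "usum_map (A i) P (j i) (opair (ucode U) g) = q"
          by (simp add: usum_map_opair[OF U g] q)
        then show "q \<in> (\<lambda>(i, p). usum_map (A i) P (j i) p) ` (SIGMA i:I. elts (usum (A i)))"
          using i usumI[OF U g] by (intro image_eqI[of _ _ "(i, opair (ucode U) g)"]) auto
      qed
    qed
  qed
  moreover have "bij_betw (\<lambda>(i, p). FMap usums (A i) P (j i) p) (SIGMA i:I. elts (FObj usums (A i)))
      (elts (FObj usums P)) \<longleftrightarrow>
    bij_betw (\<lambda>(i, p). usum_map (A i) P (j i) p) (SIGMA i:I. elts (usum (A i))) (elts (usum P))"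
    unfolding usums_simps(1) by (rule bij_betw_cong) (use j in auto)
  ultimately show "is_coproduct Sets I (\<lambda>i. FObj usums (A i)) (FObj usums P)
      (\<lambda>i. FMap usums (A i) P (j i))"
    unfolding coproduct_Set_iff using usum_map_PiE[OF j] j by simp
qed

text \<open>An element coming from the sum over \<open>A\<close> is tagged with an ultrafilter
  pushed forward from \<open>A\<close>, and such an ultrafilter contains \<open>A\<close>. Hence the
  support lies in the tag \<open>U\<close>, and maximality gives equality.\<close>

lemma support_usums:
  assumes U: "ultrafilter_on (elts X) U" and g: "g \<in> elts (FObj G (X, U))"
  shows "support usums X (opair (ucode U) g) = U"
proof (rule ultrafilter_maximal)
  show "ultrafilter_on (elts X) (support usums X (opair (ucode U) g))"
    using usumI[OF U g] by (intro ultrafilter_support is_functor_usums usums_preserves) simp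
  show "ultrafilter_on (elts X) U" by fact
  show "support usums X (opair (ucode U) g) \<subseteq> U"
  proof
    fix A assume "A \<in> support usums X (opair (ucode U) g)"
    then obtain p where A: "A \<subseteq> elts X" and p: "p \<in> elts (usum (setof A))"
      and eq: "opair (ucode U) g = FMap usums (setof A) X (\<lambda>a\<in>A. a) p"
      by (auto simp: support_def)
    have i: "(\<lambda>a\<in>A. a) \<in> elts (setof A) \<rightarrow>\<^sub>E elts X" by (rule inclusion_PiE[OF A])
    obtain V k where V: "ultrafilter_on (elts (setof A)) V" and k: "k \<in> elts (FObj G (setof A, V))"
      and p: "p = opair (ucode V) k" using p by (rule usumE)
    have "U = push (setof A) X (\<lambda>a\<in>A. a) V"
      using eq i by (simp add: p usum_map_opair[OF V k] ucode_ultrafilter_eq_iff[OF U ultrafilter_push[OF V i]])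
    moreover have "{a \<in> A. (\<lambda>a\<in>A. a) a \<in> A} = A" by auto
    ultimately show "A \<in> U"
      using A ultrafilter_top[OF V] by (simp add: pushforward_def)
  qed
qed

text \<open>The stalk at \<open>(X, U)\<close> is exactly the summand tagged with \<open>U\<close>,
  by \<open>support_usums\<close>; attaching the tag is therefore the required isomorphism.\<close>

lemma stalks_usums_iso: "\<exists>e. isomorphism UFSet G (stalks usums) e"
proof -
  note UG = is_functor_stalks[OF is_functor_usums usums_preserves]
  define e where "e = (\<lambda>P\<in>Obj UF. \<lambda>g\<in>elts (FObj G P). opair (ucode (snd P)) g)"
  have e: "e (X, U) g = opair (ucode U) g" if "ultrafilter_on (elts X) U" "g \<in> elts (FObj G (X, U))" for X U g
    using that by (simp add: e_def)
  have e_hom: "e (X, U) \<in> elts (FObj G (X, U)) \<rightarrow>\<^sub>E elts (stalk usums (X, U))"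
    if "ultrafilter_on (elts X) U" for X U
    using that by (auto simp: e_def usumI support_usums)
  have nat: "e \<in> nat_trans UF Sets G (stalks usums)"
  proof (rule nat_trans_SetI[OF G UG])
    show "e P \<in> elts (FObj G P) \<rightarrow>\<^sub>E elts (FObj (stalks usums) P)" if "P \<in> Obj UF" for P
      using that e_hom by (cases P) (simp del: stalk_iff)
    show "e P = undefined" if "P \<notin> Obj UF" for P using that by (simp add: e_def)
    fix P Q c g assume P: "P \<in> Obj UF" and Q: "Q \<in> Obj UF" and c: "c \<in> Hom UF P Q"
      and g: "g \<in> elts (FObj G P)"
    obtain X U Y V where PQ: "P = (X, U)" "Q = (Y, V)" by (cases P, cases Q)
    have U: "ultrafilter_on (elts X) U" and V: "ultrafilter_on (elts Y) V"
      using P Q by (simp_all add: PQ)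
    have g: "g \<in> elts (FObj G (X, U))" using g by (simp add: PQ)
    obtain f where f: "f \<in> elts X \<rightarrow>\<^sub>E elts Y" and push: "push X Y f U = V"
      and c: "c = arrow X U Y V f"
      using arrow_cases[OF U V] c unfolding PQ by metis
    have Gc: "FMap G P Q c = act G X U Y f" by (simp add: act_def push PQ c)
    have "opair (ucode U) g \<in> elts (stalk usums (X, U))"
      using PiE_mem[OF e_hom[OF U] g] by (simp add: e[OF U g])
    then have "FMap (stalks usums) P Q c (e P g) = opair (ucode V) (act G X U Y f g)"
      unfolding PQ c stalks_arrow[OF is_functor_usums U f push]
      using f by (simp add: e[OF U g] usum_map_opair[OF U g] push del: stalk_iff)
    moreover have "e Q (FMap G P Q c g) = opair (ucode V) (act G X U Y f g)"
      unfolding Gc unfolding PQ using e[OF V] act_mem[OF U f g] push by simp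
    ultimately show "e Q (FMap G P Q c g) = FMap (stalks usums) P Q c (e P g)" by simp
  qed
  have "isomorphism Sets (FObj G P) (FObj (stalks usums) P) (e P)" if "P \<in> Obj UF" for P
  proof -
    obtain X U where P: "P = (X, U)" by (cases P)
    have U: "ultrafilter_on (elts X) U" using that by (simp add: P)
    have "bij_betw (e (X, U)) (elts (FObj G (X, U))) (elts (stalk usums (X, U)))"
    proof (rule bij_betw_imageI)
      show "inj_on (e (X, U)) (elts (FObj G (X, U)))"
        by (rule inj_onI) (simp add: e[OF U])
      show "e (X, U) ` elts (FObj G (X, U)) = elts (stalk usums (X, U))"
      proof
        show "e (X, U) ` elts (FObj G (X, U)) \<subseteq> elts (stalk usums (X, U))"
          using PiE_mem[OF e_hom[OF U]] by blast
        show "elts (stalk usums (X, U)) \<subseteq> e (X, U) ` elts (FObj G (X, U))"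
        proof
          fix q assume "q \<in> elts (stalk usums (X, U))"
          then have q: "q \<in> elts (usum X)" "support usums X q = U" by simp_all
          from q(1) obtain W h where W: "ultrafilter_on (elts X) W" "h \<in> elts (FObj G (X, W))"
            and qW: "q = opair (ucode W) h" by (rule usumE)
          have "W = U" using support_usums[OF W] q(2) qW by simp
          then show "q \<in> e (X, U) ` elts (FObj G (X, U))"
            using W e[OF W] qW by (intro image_eqI[of _ _ h]) simp_all
        qed
      qed
    qed
    then show ?thesis
      using isomorphism_Set[OF e_hom[OF U]] that by (simp add: P)
  qed
  from isomorphism_functor_category[OF category_Set G UG nat this] show ?thesis by blast
qed

end

theorem FC_equivalent_UFSet: "equivalent_categories FC UFSet"
proof (rule equivalent_categories_fully_faithful)
  show "category FC"
    unfolding FC_category_def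
    by (intro category_full_subcategory category_functor_category category_Set)
  show "category UFSet"
    by (intro category_functor_category category_Set)
  show "is_functor FC UFSet stalks_functor" by (rule is_functor_stalks_functor)
  show "bij_betw (FMap stalks_functor F G) (Hom FC F G)
      (Hom UFSet (FObj stalks_functor F) (FObj stalks_functor G))"
    if "F \<in> Obj FC" "G \<in> Obj FC" for F G
  proof -
    have "bij_betw (FMap stalks_functor F G) (Hom FC F G) (nat_trans UF Sets (stalks F) (stalks G)) \<longleftrightarrow>
        bij_betw (stalks_nat F) (nat_trans Sets Sets F G) (nat_trans UF Sets (stalks F) (stalks G))"
      unfolding FC_simps(2) by (rule bij_betw_cong) (use that in \<open>simp del: FC_simps(1)\<close>)
    then show ?thesis using bij_betw_stalks_nat[OF that] that by (simp del: FC_simps(1))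
  qed
  show "\<exists>F\<in>Obj FC. \<exists>e. isomorphism UFSet G (FObj stalks_functor F) e" if "G \<in> Obj UFSet" for G
  proof -
    have G: "is_functor UF Sets G" using that by simp
    have "usums G \<in> Obj FC" using is_functor_usums[OF G] usums_preserves[OF G] by simp
    with stalks_usums_iso[OF G] show ?thesis
      by (intro bexI[of _ "usums G"]) (simp del: FC_simps(1))
  qed
qed

end

theorem theorem13:
  fixes elts :: "'v \<Rightarrow> 'v set"
  assumes "set_universe elts"
  shows "equivalent_categories
           (FC_category (Set_category elts) (Set_category elts))
           (functor_category (UF_category elts) (Set_category elts))"
  by (rule set_universe.FC_equivalent_UFSet[OF assms])

end
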